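(* Let $p>0$, let $\mathbb{T}$ be a $p$-periodic time scale, and let $A:\mathbb{T}\to\mathbb{R}^{n\times n}$ be $p$-periodic and uniformly regressive. Then the following are equivalent: (a) for all $t_0\in\mathbb{T}$ and for all $p$-periodic $f\in C_{\mathrm{prd}}(\mathbb{T},\mathbb{R}^{n\times1})$, there exists an initial state $x(t_0)=x_0$ such that the solution of $$x^\Delta(t)=A(t)x(t)+f(t),\quad x(t_0)=x_0$$ is $p$-periodic; (b) there do not exist a nonzero $z_0\in\mathbb{R}^n$ and $t_0\in\mathbb{T}$ such that the homogeneous initial value problem $$z^\Delta(t)=A(t)z(t),\quad z(t_0)=z_0$$ has a $p$-periodic solution.
   Context: A time scale $\mathbb{T}$ is a nonempty closed subset of $\mathbb{R}$; $\sigma(t)=\inf\{s\in\mathbb{T}:s>t\}$, $\mu(t)=\sigma(t)-t$, $f^\Delta$ is the delta (Hilger) derivative and $\int\cdot\,\Delta\tau$ the delta integral. $\mathbb{T}$ is $p$-periodic if for all $t\in\mathbb{T}$: $t+p\in\mathbb{T}$ and $\mu(t)=\mu(t+p)$; it is assumed that $0\le\mu(t)\le p$. A function $F$ on $\mathbb{T}$ is $p$-periodic if $F(t+p)=F(t)$ for all $t\in\mathbb{T}$. $f$ is rd-continuous if continuous at right-dense points with finite left-sided limits at left-dense points; $C_{\mathrm{prd}}$ denotes piecewise rd-continuous functions (every bounded interval of $\mathbb{T}$ is a finite union of half-open intervals $[a,b)\cap\mathbb{T}$ on each of which $f$ is the restriction of an rd-continuous function). $A$ is regressive if it is rd-continuous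 and $I+\mu(t)A(t)$ is invertible for all $t$; it is uniformly regressive if moreover there is $\delta>0$ such that $0<\delta^{-1}\le|1+\mu(t)\gamma(t)|$ for all $t$ and every eigenvalue $\gamma(t)$ of $A(t)$. $\Phi_A(t,\tau)$ is the unique solution of $X^\Delta=A(t)X$, $X(\tau)=I$; the solution of the nonhomogeneous problem is $x(t)=\Phi_A(t,t_0)x_0+\int_{t_0}^t\Phi_A(t,\sigma(\tau))f(\tau)\Delta\tau$. *)

theory Defs
  imports "HOL-Analysis.Analysis"
begin

text \<open>
  Functions on a time scale \<open>T\<close> are total functions on \<open>real\<close>; every notion below depends only on
  their values at points of \<open>T\<close>.
\<close>

section \<open>Time scales\<close>

definition time_scale :: "real set \<Rightarrow> bool" where
  "time_scale T \<longleftrightarrow> closed T \<and> T \<noteq> {}"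

text \<open>The usual conventions \<open>inf {} = sup T\<close> and \<open>sup {} = inf T\<close> make the jump operators fix a
  maximum and a minimum of \<open>T\<close>, respectively.\<close>

definition forward_jump :: "real set \<Rightarrow> real \<Rightarrow> real" where
  "forward_jump T t = (if \<exists>s\<in>T. t < s then Inf {s\<in>T. t < s} else t)"

definition backward_jump :: "real set \<Rightarrow> real \<Rightarrow> real" where
  "backward_jump T t = (if \<exists>s\<in>T. s < t then Sup {s\<in>T. s < t} else t)"

definition graininess :: "real set \<Rightarrow> real \<Rightarrow> real" where
  "graininess T t = forward_jump T t - t"

definition right_dense :: "real set \<Rightarrow> real \<Rightarrow> bool" where
  "right_dense T t \<longleftrightarrow> t \<in> T \<and> (\<exists>s\<in>T. t < s) \<and> forward_jump T t = t"

definition left_dense :: "real set \<Rightarrow> real \<Rightarrow> bool" where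
  "left_dense T t \<longleftrightarrow> t \<in> T \<and> (\<exists>s\<in>T. s < t) \<and> backward_jump T t = t"

text \<open>The requirement is one-sided: \<open>t - p\<close> need not belong to \<open>T\<close>.\<close>

definition periodic_time_scale :: "real set \<Rightarrow> real \<Rightarrow> bool" where
  "periodic_time_scale T p \<longleftrightarrow> time_scale T \<and>
     (\<forall>t\<in>T. t + p \<in> T \<and> graininess T t = graininess T (t + p) \<and>
            0 \<le> graininess T t \<and> graininess T t \<le> p)"

definition periodic_on :: "real set \<Rightarrow> real \<Rightarrow> (real \<Rightarrow> 'a) \<Rightarrow> bool" where
  "periodic_on T p F \<longleftrightarrow> (\<forall>t\<in>T. F (t + p) = F t)"


section \<open>Rd-continuity\<close>

definition rd_continuous :: "real set \<Rightarrow> (real \<Rightarrow> 'a::topological_space) \<Rightarrow> bool" where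
  "rd_continuous T f \<longleftrightarrow>
     (\<forall>t. right_dense T t \<longrightarrow> continuous (at t within T) f) \<and>
     (\<forall>t. left_dense T t \<longrightarrow> (\<exists>l. (f \<longlongrightarrow> l) (at t within (T \<inter> {..<t}))))"

text \<open>It suffices to decompose the bounded intervals of the form \<open>[a,b)\<close>, which exhaust \<open>T\<close>; a compact
  interval whose right end point is right-dense is not itself a union of half-open intervals.\<close>

definition C_prd :: "real set \<Rightarrow> (real \<Rightarrow> 'a::topological_space) set" where
  "C_prd T = {f. \<forall>a b. \<exists>S. finite S \<and>
       {a..<b} \<inter> T = (\<Union>(c, d)\<in>S. {c..<d} \<inter> T) \<and>
       (\<forall>(c, d)\<in>S. \<exists>g. rd_continuous T g \<and> (\<forall>t\<in>{c..<d} \<inter> T. f t = g t))}"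


section \<open>Delta derivative and delta integral\<close>

text \<open>If \<open>T\<close> has a left-scattered maximum, then every \<open>D\<close> is a delta derivative there, so that
  quantifying over \<open>T\<close> in what follows amounts to quantifying over \<open>T\<close> without that point.\<close>

definition has_delta_derivative ::
    "real set \<Rightarrow> (real \<Rightarrow> 'a::real_normed_vector) \<Rightarrow> 'a \<Rightarrow> real \<Rightarrow> bool" where
  "has_delta_derivative T f D t \<longleftrightarrow>
     (\<forall>\<epsilon>>0. \<exists>\<delta>>0. \<forall>s\<in>T. \<bar>s - t\<bar> < \<delta> \<longrightarrow>
        norm (f (forward_jump T t) - f s - (forward_jump T t - s) *\<^sub>R D)
          \<le> \<epsilon> * \<bar>forward_jump T t - s\<bar>)"

text \<open>Pre-antiderivatives: the derivative may fail to be \<open>f\<close> on a countable set without right-scattered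
  points. This is what is available for piecewise rd-continuous \<open>f\<close>.\<close>

definition delta_pre_antiderivative ::
    "real set \<Rightarrow> (real \<Rightarrow> 'a::real_normed_vector) \<Rightarrow> (real \<Rightarrow> 'a) \<Rightarrow> bool" where
  "delta_pre_antiderivative T f F \<longleftrightarrow> continuous_on T F \<and>
     (\<exists>D\<subseteq>T. countable (T - D) \<and> (\<forall>t\<in>T - D. forward_jump T t = t) \<and>
        (\<forall>t\<in>D. has_delta_derivative T F (f t) t))"

text \<open>The Cauchy delta integral from \<open>a\<close> to \<open>b\<close>, oriented, for \<open>a\<close> and \<open>b\<close> in \<open>T\<close>.\<close>

definition delta_integral ::
    "real set \<Rightarrow> real \<Rightarrow> real \<Rightarrow> (real \<Rightarrow> 'a::real_normed_vector) \<Rightarrow> 'a" where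
  "delta_integral T a b f = (THE I. \<exists>F. delta_pre_antiderivative T f F \<and> I = F b - F a)"


section \<open>Linear systems\<close>

definition regressive :: "real set \<Rightarrow> (real \<Rightarrow> real^'n^'n) \<Rightarrow> bool" where
  "regressive T A \<longleftrightarrow> rd_continuous T A \<and>
     (\<forall>t\<in>T. invertible (mat 1 + graininess T t *\<^sub>R A t))"

definition complex_eigenvalue :: "real^'n^'n \<Rightarrow> complex \<Rightarrow> bool" where
  "complex_eigenvalue M \<gamma> \<longleftrightarrow>
     (\<exists>v::complex^'n. v \<noteq> 0 \<and> (\<chi> i j. complex_of_real (M $ i $ j)) *v v = \<gamma> *s v)"

definition uniformly_regressive :: "real set \<Rightarrow> (real \<Rightarrow> real^'n^'n) \<Rightarrow> bool" where
  "uniformly_regressive T A \<longleftrightarrow> regressive T A \<and>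
     (\<exists>\<delta>>0. \<forall>t\<in>T. \<forall>\<gamma>. complex_eigenvalue (A t) \<gamma> \<longrightarrow>
        0 < inverse \<delta> \<and> inverse \<delta> \<le> cmod (1 + complex_of_real (graininess T t) * \<gamma>))"

definition homogeneous_solution ::
    "real set \<Rightarrow> (real \<Rightarrow> real^'n^'n) \<Rightarrow> real \<Rightarrow> real^'n \<Rightarrow> (real \<Rightarrow> real^'n) \<Rightarrow> bool" where
  "homogeneous_solution T A t0 z0 z \<longleftrightarrow>
     (\<forall>t\<in>T. has_delta_derivative T z (A t *v z t) t) \<and> z t0 = z0"

text \<open>The matrix solution is unique only as a function on \<open>T\<close>, hence the definite description of its
  value at \<open>t\<close> (for \<open>t\<close> and \<open>\<tau>\<close> in \<open>T\<close>).\<close>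

definition transition_matrix ::
    "real set \<Rightarrow> (real \<Rightarrow> real^'n^'n) \<Rightarrow> real \<Rightarrow> real \<Rightarrow> real^'n^'n" where
  "transition_matrix T A t \<tau> =
     (THE M. \<exists>X. (\<forall>s\<in>T. has_delta_derivative T X (A s ** X s) s) \<and> X \<tau> = mat 1 \<and> M = X t)"

text \<open>For piecewise rd-continuous \<open>f\<close> the equation \<open>x\<^sup>\<Delta> = A x + f\<close> can fail at the jumps of \<open>f\<close>; its
  solution with value \<open>x0\<close> at \<open>t0\<close> is the function given by variation of constants.\<close>

definition nonhomogeneous_solution ::
    "real set \<Rightarrow> (real \<Rightarrow> real^'n^'n) \<Rightarrow> (real \<Rightarrow> real^'n) \<Rightarrow> real \<Rightarrow> real^'n \<Rightarrow> real \<Rightarrow> real^'n" where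
  "nonhomogeneous_solution T A f t0 x0 t =
     transition_matrix T A t t0 *v x0 +
     delta_integral T t0 t (\<lambda>\<tau>. transition_matrix T A t (forward_jump T \<tau>) *v f \<tau>)"

end

theory Submission
  imports Defs
begin

text \<open>
  By uniqueness of solutions, \<open>\<Phi>(t + p, s + p) = \<Phi>(t, s)\<close>. Hence a solution of the homogeneous
  equation is periodic iff its value at \<open>t0\<close> is fixed by the monodromy matrix \<open>B = \<Phi>(t0 + p, t0)\<close>, and
  the solution of the nonhomogeneous equation starting in \<open>x0\<close> is periodic iff \<open>(I - B) x0 = B J\<close>,
  where \<open>J\<close> is the integral of \<open>\<Phi>(t0, \<sigma>(\<tau>)) f(\<tau>)\<close> over one period. As \<open>f\<close> varies, \<open>J\<close> takes every
  value, so both statements say that \<open>I - B\<close> is invertible.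

  Delta integrals are reduced to ordinary ones: \<open>\<integral> h \<Delta>\<tau>\<close> is the integral of \<open>h\<close> composed with
  \<open>x \<mapsto> sup {s \<in> T. s \<le> x}\<close>. Solutions forward in time come from Picard iteration; regressivity makes
  them invertible, which yields the solutions backward in time.
\<close>

section \<open>Jump operators, delta derivatives and the mean value inequality\<close>

text \<open>Periodicity of \<open>T\<close> is one-sided: \<open>t - p\<close> may lie outside
  \<open>T\<close>, and \<open>T\<close> may or may not have a least point. A solution to the left
  of \<open>t0\<close> therefore cannot be obtained by translating one from the right; it is
  assembled from solutions on half-lines \<open>T \<inter> {a..}\<close>. What survives is that
  \<open>T\<close> is unbounded above, so the forward jump is always the infimum of a nonempty set.
  The second obstacle is that \<open>f\<close> may jump at right-dense points. Antiderivatives then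
  differentiate to the integrand only off a countable set, and their uniqueness up to constants, on
  which the meaning of every delta integral rests, needs a mean value inequality that tolerates such
  a set. The forcing built to realise a prescribed \<open>J\<close> has such jumps in general, at
  the points \<open>t0 + j p\<close> where consecutive periods meet.\<close>

locale unbounded_time_scale =
  fixes T :: "real set"
  assumes closed_T: "closed T" and unbounded_above: "\<exists>t\<in>T. x < t"
begin

abbreviation \<sigma> :: "real \<Rightarrow> real" where "\<sigma> \<equiv> forward_jump T"

lemma forward_jump_eq: "\<sigma> t = Inf {s\<in>T. t < s}"
  using unbounded_above by (auto simp: forward_jump_def)

lemma forward_jump_le: "s \<in> T \<Longrightarrow> t < s \<Longrightarrow> \<sigma> t \<le> s"
  unfolding forward_jump_eq by (rule cInf_lower) (auto intro!: bdd_belowI[of _ t])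

lemma forward_jump_ge: "t \<le> \<sigma> t"
  unfolding forward_jump_eq using unbounded_above[of t] by (intro cInf_greatest) auto

lemma forward_jump_less_imp: "\<sigma> t < y \<Longrightarrow> \<exists>s\<in>T. t < s \<and> s < y"
  using cInf_lessD[of "{s\<in>T. t < s}" y] unbounded_above[of t] unfolding forward_jump_eq by auto

lemma forward_jump_in: assumes "t \<in> T" shows "\<sigma> t \<in> T"
proof -
  have "\<sigma> t \<in> closure {s\<in>T. t < s}"
    unfolding forward_jump_eq using unbounded_above[of t]
    by (intro closure_contains_Inf) (auto intro!: bdd_belowI[of _ t])
  also have "\<dots> \<subseteq> closure T" by (rule closure_mono) auto
  finally show ?thesis using closed_T by simp
qed

lemma right_dense_iff: "right_dense T t \<longleftrightarrow> t \<in> T \<and> \<sigma> t = t"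
  using unbounded_above by (auto simp: right_dense_def)

text \<open>The supremum of the points of \<open>T\<close> below \<open>t\<close> lies in
  \<open>T\<close> by closedness, and strictly below \<open>t\<close> since \<open>t\<close> is not
  left-dense; no point of \<open>T\<close> separates the two. Backward propagation crosses a gap by
  means of the equation at \<open>r\<close>.\<close>

lemma backward_gap:
  assumes "t \<in> T" "s \<in> T" "s < t" "\<not> left_dense T t"
  obtains r where "r \<in> T" "s \<le> r" "r < t" "\<sigma> r = t"
proof -
  let ?S = "{s\<in>T. s < t}"
  have bd: "bdd_above ?S" by (auto intro!: bdd_aboveI[of _ t])
  have eq: "backward_jump T t = Sup ?S" using assms by (auto simp: backward_jump_def)
  have ne: "Sup ?S \<noteq> t" using assms eq by (auto simp: left_dense_def)
  have "Sup ?S \<le> t" using assms by (intro cSup_least) auto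
  with ne have lt: "Sup ?S < t" by simp
  have "Sup ?S \<in> closure ?S" using assms by (intro closure_contains_Sup bd) auto
  also have "\<dots> \<subseteq> closure T" by (rule closure_mono) auto
  finally have in_T: "Sup ?S \<in> T" using closed_T by simp
  have "s \<le> Sup ?S" using assms by (intro cSup_upper bd) auto
  moreover have "\<sigma> (Sup ?S) = t"
  proof (rule antisym)
    show "\<sigma> (Sup ?S) \<le> t" using assms lt by (intro forward_jump_le)
    show "t \<le> \<sigma> (Sup ?S)"
    proof (rule ccontr)
      assume "\<not> t \<le> \<sigma> (Sup ?S)"
      then obtain r where "r \<in> T" "Sup ?S < r" "r < t" using forward_jump_less_imp by force
      then show False using cSup_upper[OF _ bd, of r] by simp
    qed
  qed
  ultimately show thesis using that in_T lt by blast
qed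

lemma has_delta_derivative_jump:
  assumes "has_delta_derivative T F D t" "t \<in> T"
  shows "F (\<sigma> t) - F t = (\<sigma> t - t) *\<^sub>R D"
proof -
  \<comment> \<open>The summand 1 keeps \<open>m\<close> positive where the graininess is 0.\<close>
  define m where "m = \<bar>\<sigma> t - t\<bar> + 1"
  have "m > 0" unfolding m_def by linarith
  have "norm (F (\<sigma> t) - F t - (\<sigma> t - t) *\<^sub>R D) \<le> e" if "e > 0" for e
  proof -
    have "e / m > 0" using that \<open>m > 0\<close> by simp
    then have "norm (F (\<sigma> t) - F t - (\<sigma> t - t) *\<^sub>R D) \<le> e / m * \<bar>\<sigma> t - t\<bar>"
      using assms unfolding has_delta_derivative_def by fastforce
    also have "\<dots> \<le> e / m * m" using \<open>e / m > 0\<close> unfolding m_def by (intro mult_left_mono) auto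
    also have "\<dots> = e" using \<open>m > 0\<close> by simp
    finally show ?thesis .
  qed
  then have "norm (F (\<sigma> t) - F t - (\<sigma> t - t) *\<^sub>R D) \<le> 0" by (rule field_le_epsilon) simp
  then show ?thesis by simp
qed

lemma has_delta_derivative_dense:
  assumes "has_delta_derivative T F D t" "\<sigma> t = t" "e > 0"
  obtains d where "d > 0"
    "\<And>s. s \<in> T \<Longrightarrow> \<bar>s - t\<bar> < d \<Longrightarrow> norm (F s - F t - (s - t) *\<^sub>R D) \<le> e * \<bar>s - t\<bar>"
proof -
  obtain d where "d > 0" and d: "\<And>s. s \<in> T \<Longrightarrow> \<bar>s - t\<bar> < d \<Longrightarrow>
      norm (F t - F s - (t - s) *\<^sub>R D) \<le> e * \<bar>t - s\<bar>"
    using assms(1,3) unfolding has_delta_derivative_def by (metis assms(2))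
  have "norm (F t - F s - (t - s) *\<^sub>R D) = norm (F s - F t - (s - t) *\<^sub>R D)" for s
    by (subst norm_minus_cancel[symmetric]) (simp add: algebra_simps)
  then show thesis using that \<open>d > 0\<close> d by (simp add: abs_minus_commute)
qed

text \<open>The definition controls \<open>F s\<close> only relative to
  \<open>F (\<sigma> t)\<close>; inserting the exact jump formula for
  \<open>F (\<sigma> t) - F t\<close> turns this into an estimate of
  \<open>F s - F t\<close>.\<close>

lemma has_delta_derivative_continuous:
  assumes "has_delta_derivative T F D t" "t \<in> T"
  shows "continuous (at t within T) F"
  unfolding continuous_within_eps_delta
proof (intro allI impI)
  fix e :: real assume "e > 0"
  define m where "m = \<sigma> t - t"
  have "m \<ge> 0" using forward_jump_ge by (simp add: m_def)
  \<comment> \<open>This choice and the third entry of \<open>d'\<close> make the error term and the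
    term with \<open>norm D\<close> contribute at most \<open>e / 4\<close> each.\<close>
  define e' where "e' = e / (4 * (m + 1))"
  have "e' > 0" using \<open>e > 0\<close> \<open>m \<ge> 0\<close> by (simp add: e'_def)
  obtain d where "d > 0" and d: "\<And>s. s \<in> T \<Longrightarrow> \<bar>s - t\<bar> < d \<Longrightarrow>
      norm (F (\<sigma> t) - F s - (\<sigma> t - s) *\<^sub>R D) \<le> e' * \<bar>\<sigma> t - s\<bar>"
    using assms(1) \<open>e' > 0\<close> unfolding has_delta_derivative_def by meson
  define d' where "d' = Min {d, 1, e / (4 * (norm D + 1))}"
  have "d' > 0" using \<open>d > 0\<close> \<open>e > 0\<close> by (auto simp: d'_def intro!: divide_pos_pos add_nonneg_pos)
  have "norm (F s - F t) < e" if s: "s \<in> T" "\<bar>s - t\<bar> < d'" for s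
  proof -
    have 1: "\<bar>s - t\<bar> < d" "\<bar>s - t\<bar> < 1" "\<bar>s - t\<bar> < e / (4 * (norm D + 1))" using s by (auto simp: d'_def)
    have "F s - F t = (F (\<sigma> t) - F t) - (F (\<sigma> t) - F s - (\<sigma> t - s) *\<^sub>R D) - (\<sigma> t - s) *\<^sub>R D" by simp
    also have "F (\<sigma> t) - F t = (\<sigma> t - t) *\<^sub>R D" by (rule has_delta_derivative_jump[OF assms])
    finally have "F s - F t = (s - t) *\<^sub>R D - (F (\<sigma> t) - F s - (\<sigma> t - s) *\<^sub>R D)"
      by (simp add: algebra_simps)
    then have "norm (F s - F t) \<le> norm ((s - t) *\<^sub>R D) + norm (F (\<sigma> t) - F s - (\<sigma> t - s) *\<^sub>R D)"
      by (metis norm_triangle_ineq4)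
    also have "\<dots> \<le> \<bar>s - t\<bar> * norm D + e' * \<bar>\<sigma> t - s\<bar>" using d[OF s(1) 1(1)] by simp
    also have "\<bar>\<sigma> t - s\<bar> \<le> m + 1" using 1 \<open>m \<ge> 0\<close> unfolding m_def by linarith
    also have "\<bar>s - t\<bar> * norm D \<le> e / (4 * (norm D + 1)) * (norm D + 1)"
      using 1 by (intro mult_mono) auto
    also have "\<dots> = e / 4" by (simp add: field_simps add_nonneg_eq_0_iff)
    also have "e' * (m + 1) = e / 4" using \<open>m \<ge> 0\<close> by (simp add: e'_def divide_simps)
    finally show ?thesis using \<open>e > 0\<close> \<open>e' > 0\<close> by simp
  qed
  then show "\<exists>d>0. \<forall>x'\<in>T. dist x' t < d \<longrightarrow> dist (F x') (F t) < e"
    using \<open>d' > 0\<close> by (auto simp: dist_norm)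
qed

lemma has_delta_derivative_continuous_on:
  "(\<And>t. t \<in> T \<Longrightarrow> has_delta_derivative T F (G t) t) \<Longrightarrow> continuous_on T F"
  using has_delta_derivative_continuous continuous_on_eq_continuous_within by blast

text \<open>If the bound failed, the function \<open>\<phi>\<close> below would take uncountably many values at last
  crossing points, none of which can be a point of differentiability.\<close>

lemma delta_mean_value:
  assumes cont: "continuous_on T F" and ab: "a \<in> T" "b \<in> T" "a \<le> b"
    and N: "countable N" "\<And>t. t \<in> N \<Longrightarrow> \<sigma> t = t"
    and der: "\<And>t. t \<in> T \<Longrightarrow> a \<le> t \<Longrightarrow> t < b \<Longrightarrow> t \<notin> N \<Longrightarrow> \<exists>D. has_delta_derivative T F D t \<and> norm D \<le> C"
  shows "norm (F b - F a) \<le> C * (b - a)"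
proof (cases "a = b")
  case False
  then have "a < b" using ab by simp
  \<comment> \<open>The slack \<open>\<eta>\<close> is the tolerance at which the derivative is used
    at a right-dense point; at the end it tends to 0.\<close>
  have bound: "norm (F b - F a) \<le> (C + \<eta>) * (b - a)" if "\<eta> > 0" for \<eta>
  proof (rule ccontr)
    assume contra: "\<not> ?thesis"
    define \<phi> where "\<phi> t = norm (F t - F a) - (C + \<eta>) * (t - a)" for t
    have \<phi>_a: "\<phi> a = 0" by (simp add: \<phi>_def)
    have \<phi>_b: "\<phi> b > 0" using contra by (simp add: \<phi>_def)
    have cont_\<phi>: "continuous_on T \<phi>" unfolding \<phi>_def using cont by (intro continuous_intros)
    have "\<exists>m\<in>N \<inter> T. \<phi> m = y" if y: "0 < y" "y < \<phi> b" for y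
    proof -
      define S where "S = {t \<in> T \<inter> {a..b}. \<phi> t \<le> y}"
      have "continuous_on (T \<inter> {a..b}) \<phi>" using cont_\<phi> by (rule continuous_on_subset) auto
      then have "closed (T \<inter> {a..b} \<inter> \<phi> -` {..y})"
        using closed_T by (intro continuous_closed_preimage) auto
      also have "T \<inter> {a..b} \<inter> \<phi> -` {..y} = S" by (auto simp: S_def)
      finally have "closed S" .
      moreover have "bounded S" by (rule bounded_subset[of "{a..b}"]) (auto simp: S_def)
      ultimately have "compact S" by (simp add: compact_eq_bounded_closed)
      moreover have "a \<in> S" using ab \<phi>_a y by (simp add: S_def)
      ultimately obtain m where m: "m \<in> S" "\<And>t. t \<in> S \<Longrightarrow> t \<le> m"
        using compact_attains_sup[of S] by blast
      then have mT: "m \<in> T" "a \<le> m" "m \<le> b" "\<phi> m \<le> y" by (auto simp: S_def)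
      have "m < b" using mT y by (cases "m = b") auto
      have gt: "\<phi> t > y" if "t \<in> T" "m < t" "t \<le> b" for t
        using m(2)[of t] that mT by (force simp: S_def)
      \<comment> \<open>Off \<open>N\<close> the derivative bound yields a point of \<open>T\<close>
        to the right of \<open>m\<close>, a nearby one or \<open>\<sigma> m\<close>, where
        \<open>\<phi>\<close> is still at most \<open>\<phi> m\<close>. This contradicts the choice
        of \<open>m\<close> as the last point with \<open>\<phi> \<le> y\<close>.\<close>
      have "m \<in> N"
      proof (rule ccontr)
        assume "m \<notin> N"
        then obtain D where D: "has_delta_derivative T F D m" "norm D \<le> C" using der mT \<open>m < b\<close> by blast
        have step: "\<phi> s \<le> \<phi> m" if "s > m" "norm (F s - F m) \<le> (C + \<eta>) * (s - m)" for s
        proof -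
          have "norm (F s - F a) \<le> norm (F s - F m) + norm (F m - F a)"
            using norm_triangle_ineq[of "F s - F m" "F m - F a"] by simp
          then show ?thesis using that by (simp add: \<phi>_def algebra_simps)
        qed
        show False
        proof (cases "\<sigma> m = m")
          case True
          obtain d where "d > 0" and d: "\<And>s. s \<in> T \<Longrightarrow> \<bar>s - m\<bar> < d \<Longrightarrow>
              norm (F s - F m - (s - m) *\<^sub>R D) \<le> \<eta> * \<bar>s - m\<bar>"
            using has_delta_derivative_dense[OF D(1) True \<open>\<eta> > 0\<close>] by blast
          obtain s where s: "s \<in> T" "m < s" "s < min b (m + d)"
            using forward_jump_less_imp[of m "min b (m + d)"] True \<open>m < b\<close> \<open>d > 0\<close> by auto
          have "norm (F s - F m) \<le> norm (F s - F m - (s - m) *\<^sub>R D) + norm ((s - m) *\<^sub>R D)"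
            using norm_triangle_ineq[of "F s - F m - (s - m) *\<^sub>R D" "(s - m) *\<^sub>R D"] by simp
          also have "\<dots> \<le> \<eta> * (s - m) + (s - m) * C"
            using d[of s] s D(2) by (intro add_mono) (auto simp: mult_left_mono)
          finally have "\<phi> s \<le> \<phi> m" using s by (intro step) (auto simp: algebra_simps)
          then show False using gt[of s] s mT by auto
        next
          case False
          then have s: "\<sigma> m \<in> T" "m < \<sigma> m" "\<sigma> m \<le> b"
            using forward_jump_in forward_jump_ge[of m] forward_jump_le[of b m] mT \<open>m < b\<close> ab by auto
          have "norm (F (\<sigma> m) - F m) = (\<sigma> m - m) * norm D"
            using has_delta_derivative_jump[OF D(1) mT(1)] s by simp
          also have "\<dots> \<le> (\<sigma> m - m) * (C + \<eta>)" using D(2) s \<open>\<eta> > 0\<close> by (intro mult_left_mono) auto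
          finally have "\<phi> (\<sigma> m) \<le> \<phi> m" using s by (intro step) (auto simp: algebra_simps)
          then show False using gt[of "\<sigma> m"] s mT by auto
        qed
      qed
      \<comment> \<open>Points of \<open>N\<close> are right-dense, so if \<open>\<phi> m\<close>
        were below \<open>y\<close>, continuity would keep \<open>\<phi>\<close> below
        \<open>y\<close> at some later point. The level is thus attained exactly, and different
        levels need different points of \<open>N\<close>.\<close>
      moreover have "\<phi> m \<ge> y"
      proof (rule ccontr)
        assume "\<not> y \<le> \<phi> m"
        then have "y - \<phi> m > 0" by simp
        then obtain d where "d > 0" and d: "\<And>s. s \<in> T \<Longrightarrow> \<bar>s - m\<bar> < d \<Longrightarrow> \<bar>\<phi> s - \<phi> m\<bar> < y - \<phi> m"
          using cont_\<phi> mT(1) unfolding continuous_on_iff dist_real_def by metis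
        obtain s where s: "s \<in> T" "m < s" "s < min b (m + d)"
          using forward_jump_less_imp[of m "min b (m + d)"] N(2)[OF \<open>m \<in> N\<close>] \<open>m < b\<close> \<open>d > 0\<close> by auto
        then show False using d[of s] gt[of s] by auto
      qed
      ultimately show ?thesis using mT by (intro bexI[of _ m]) auto
    qed
    then have "{0<..<\<phi> b} \<subseteq> \<phi> ` N" by force
    then have "countable {0<..<\<phi> b}" using N(1) by (meson countable_image countable_subset)
    then show False using uncountable_open_interval[of 0 "\<phi> b"] \<phi>_b by blast
  qed
  have "norm (F b - F a) \<le> C * (b - a) + e" if "e > 0" for e
    using bound[of "e / (b - a)"] that \<open>a < b\<close> by (simp add: distrib_right)
  then show ?thesis by (rule field_le_epsilon)
qed simp

end


section \<open>Regulated functions and their integrals\<close>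

text \<open>Limits are demanded at all real \<open>t\<close>; on a side from which \<open>T\<close>
  does not accumulate the filter is trivial and the demand is void. Nothing ties the limits to the
  value at \<open>t\<close>, so the notion covers rd-continuous and piecewise rd-continuous
  functions alike and is stable under the products that occur in the integrands.\<close>

definition regulated_on :: "real set \<Rightarrow> (real \<Rightarrow> 'a::topological_space) \<Rightarrow> bool" where
  "regulated_on T h \<longleftrightarrow>
     (\<forall>t. (\<exists>l. (h \<longlongrightarrow> l) (at t within (T \<inter> {t<..}))) \<and> (\<exists>l. (h \<longlongrightarrow> l) (at t within (T \<inter> {..<t}))))"

lemma regulated_on_bounded_bilinear:
  assumes "bounded_bilinear bil" "regulated_on T f" "regulated_on T g"
  shows "regulated_on T (\<lambda>t. bil (f t) (g t))"
  using assms bounded_bilinear.tendsto[OF assms(1)] unfolding regulated_on_def by metis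

lemma regulated_on_locally_bounded:
  fixes h :: "real \<Rightarrow> 'a::real_normed_vector"
  assumes "regulated_on T h"
  obtains d M where "d > 0" "M > 0" "\<And>s. s \<in> T \<Longrightarrow> \<bar>s - t\<bar> < d \<Longrightarrow> norm (h s) \<le> M"
proof -
  obtain l r where l: "(h \<longlongrightarrow> l) (at t within (T \<inter> {..<t}))" and r: "(h \<longlongrightarrow> r) (at t within (T \<inter> {t<..}))"
    using assms unfolding regulated_on_def by blast
  obtain d1 where d1: "d1 > 0" "\<And>s. s \<in> T \<Longrightarrow> s < t \<Longrightarrow> \<bar>s - t\<bar> < d1 \<Longrightarrow> norm (h s - l) < 1"
    using l[unfolded Lim_within, rule_format, of 1] by (auto simp: dist_norm)
  obtain d2 where d2: "d2 > 0" "\<And>s. s \<in> T \<Longrightarrow> s > t \<Longrightarrow> \<bar>s - t\<bar> < d2 \<Longrightarrow> norm (h s - r) < 1"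
    using r[unfolded Lim_within, rule_format, of 1] by (auto simp: dist_norm)
  show thesis
  proof (rule that[of "min d1 d2" "norm l + norm r + norm (h t) + 1"])
    show "0 < min d1 d2" using d1 d2 by simp
    show "0 < norm l + norm r + norm (h t) + 1" by (simp add: add_nonneg_pos)
    fix s assume s: "s \<in> T" "\<bar>s - t\<bar> < min d1 d2"
    consider "s < t" | "s = t" | "s > t" by linarith
    then show "norm (h s) \<le> norm l + norm r + norm (h t) + 1"
    proof cases
      case 1
      then have "norm (h s - l) < 1" using d1(2)[of s] s by auto
      then show ?thesis using norm_triangle_sub[of "h s" l] norm_ge_zero[of r] norm_ge_zero[of "h t"]
        by linarith
    next
      case 2
      then show ?thesis by (simp add: add_nonneg_nonneg)
    next
      case 3
      then have "norm (h s - r) < 1" using d2(2)[of s] s by auto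
      then show ?thesis using norm_triangle_sub[of "h s" r] norm_ge_zero[of l] norm_ge_zero[of "h t"]
        by linarith
    qed
  qed
qed

text \<open>Compactness of \<open>{a..b}\<close> leaves finitely many local bounds. Their sum is a
  common bound, and the extra 1 keeps it positive when \<open>a > b\<close> and the cover is
  empty.\<close>

lemma regulated_on_bounded:
  fixes h :: "real \<Rightarrow> 'a::real_normed_vector"
  assumes "regulated_on T h"
  obtains M where "M > 0" "\<And>s. s \<in> T \<Longrightarrow> a \<le> s \<Longrightarrow> s \<le> b \<Longrightarrow> norm (h s) \<le> M"
proof -
  have "\<forall>t. \<exists>d M. d > 0 \<and> M > 0 \<and> (\<forall>s\<in>T. \<bar>s - t\<bar> < d \<longrightarrow> norm (h s) \<le> M)"
    using regulated_on_locally_bounded[OF assms] by metis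
  then obtain d M where d: "\<And>t::real. d t > (0::real)" and M: "\<And>t. M t > (0::real)"
      "\<And>t s. s \<in> T \<Longrightarrow> \<bar>s - t\<bar> < d t \<Longrightarrow> norm (h s) \<le> M t" by metis
  have "{a..b} \<subseteq> (\<Union>t\<in>{a..b}. ball t (d t))" using d by force
  then obtain D where D: "D \<subseteq> {a..b}" "finite D" "{a..b} \<subseteq> (\<Union>t\<in>D. ball t (d t))"
    using compactE_image[of "{a..b}" "{a..b}" "\<lambda>t. ball t (d t)"] by (metis compact_Icc open_ball)
  show thesis
  proof (rule that[of "(\<Sum>t\<in>D. M t) + 1"])
    show "(\<Sum>t\<in>D. M t) + 1 > 0" using M(1) by (simp add: add_nonneg_pos order_less_imp_le sum_nonneg)
    fix s assume s: "s \<in> T" "a \<le> s" "s \<le> b"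
    then obtain t where t: "t \<in> D" "\<bar>s - t\<bar> < d t" using D by (force simp: dist_real_def)
    then have "norm (h s) \<le> M t" using M s by blast
    also have "\<dots> \<le> (\<Sum>t\<in>D. M t)" using t D M(1) by (intro member_le_sum) (auto simp: less_imp_le)
    finally show "norm (h s) \<le> (\<Sum>t\<in>D. M t) + 1" by simp
  qed
qed

text \<open>Such a function is a uniform limit of step functions. Left limits are taken within
  \<open>{u..<x}\<close> because the intended integrand is uncontrolled below \<open>u\<close>,
  where \<open>T\<close> may have no points.\<close>

lemma regulated_integrable:
  fixes g :: "real \<Rightarrow> 'a::banach"
  assumes right: "\<And>x. x \<in> {u..v} \<Longrightarrow> \<exists>l. (g \<longlongrightarrow> l) (at_right x)"
    and left: "\<And>x. x \<in> {u..v} \<Longrightarrow> \<exists>l. (g \<longlongrightarrow> l) (at x within {u..<x})"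
  shows "g integrable_on {u..v}"
proof (cases "u \<le> v")
  case True
  have "\<exists>g'. (\<forall>x\<in>cbox u v. norm (g x - g' x) \<le> e) \<and> g' integrable_on cbox u v" if "e > 0" for e
  proof -
    have "\<exists>d l r. d > 0 \<and> (\<forall>y. u \<le> y \<longrightarrow> y < x \<longrightarrow> x - y < d \<longrightarrow> norm (g y - l) \<le> e) \<and>
        (\<forall>y. x < y \<longrightarrow> y - x < d \<longrightarrow> norm (g y - r) \<le> e)" if x: "x \<in> {u..v}" for x
    proof -
      obtain l r where l: "(g \<longlongrightarrow> l) (at x within {u..<x})" and r: "(g \<longlongrightarrow> r) (at_right x)"
        using left[OF x] right[OF x] by blast
      obtain d1 where d1: "d1 > 0" "\<forall>y\<in>{u..<x}. 0 < dist y x \<and> dist y x < d1 \<longrightarrow> dist (g y) l < e"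
        using l \<open>e > 0\<close> unfolding Lim_within by blast
      obtain d2 where d2: "d2 > 0" "\<forall>y\<in>{x<..}. 0 < dist y x \<and> dist y x < d2 \<longrightarrow> dist (g y) r < e"
        using r \<open>e > 0\<close> unfolding Lim_within by blast
      have "norm (g y - l) \<le> e" if "u \<le> y" "y < x" "x - y < min d1 d2" for y
        using d1(2)[rule_format, of y] that by (simp add: dist_norm)
      moreover have "norm (g y - r) \<le> e" if "x < y" "y - x < min d1 d2" for y
        using d2(2)[rule_format, of y] that by (simp add: dist_norm)
      moreover have "min d1 d2 > 0" using d1(1) d2(1) by simp
      ultimately show ?thesis by blast
    qed
    then obtain d l r where d: "\<And>x. x \<in> {u..v} \<Longrightarrow> d x > 0"
      and l: "\<And>x y. x \<in> {u..v} \<Longrightarrow> u \<le> y \<Longrightarrow> y < x \<Longrightarrow> x - y < d x \<Longrightarrow> norm (g y - l x) \<le> e"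
      and r: "\<And>x y. x \<in> {u..v} \<Longrightarrow> x < y \<Longrightarrow> y - x < d x \<Longrightarrow> norm (g y - r x) \<le> e"
      by metis
    define \<gamma> where "\<gamma> x = (if x \<in> {u..v} then ball x (d x) else ball x 1)" for x
    have "gauge \<gamma>" unfolding gauge_def \<gamma>_def using d by auto
    then obtain p where p: "p tagged_division_of {u..v}" "\<gamma> fine p"
      using fine_division_exists_real by blast
    have "\<exists>g'. (\<forall>x\<in>K. norm (g x - g' x) \<le> e) \<and> g' integrable_on K" if Kp: "K \<in> snd ` p" for K
    proof -
      obtain x where x: "(x, K) \<in> p" using Kp by force
      then have K: "x \<in> K" "K \<subseteq> {u..v}" "K \<subseteq> \<gamma> x" and "\<exists>c b. K = {c..b}"
        using tagged_division_ofD(2-4)[OF p(1) x] fineD[OF p(2) x] by auto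
      then obtain c b where cb: "K = {c..b}" by blast
      have x': "x \<in> {u..v}" "c \<le> x" "x \<le> b" using K cb by auto
      \<comment> \<open>The piece is subordinate to its tag \<open>x\<close>, so \<open>g\<close> is
        within \<open>e\<close> of \<open>l x\<close> before the tag and of \<open>r x\<close> after
        it; at the tag the exact value is kept.\<close>
      define g' where "g' y = (if y < x then l x else if y = x then g x else r x)" for y
      have "norm (g y - g' y) \<le> e" if "y \<in> K" for y
      proof -
        have "y \<in> \<gamma> x" "u \<le> y" using that K by auto
        then have "\<bar>y - x\<bar> < d x" using x' by (simp add: \<gamma>_def dist_real_def abs_minus_commute)
        then show ?thesis using l[of x y] r[of x y] x' \<open>u \<le> y\<close> \<open>e > 0\<close> by (auto simp: g'_def)
      qed
      moreover have "g' integrable_on {c..x}"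
        by (rule integrable_spike_finite[of "{x}" _ _ "\<lambda>_. l x"]) (auto simp: g'_def)
      moreover have "g' integrable_on {x..b}"
        by (rule integrable_spike_finite[of "{x}" _ _ "\<lambda>_. r x"]) (auto simp: g'_def)
      ultimately have "(\<forall>y\<in>K. norm (g y - g' y) \<le> e) \<and> g' integrable_on K"
        using Henstock_Kurzweil_Integration.integrable_combine[OF x'(2,3), of g'] cb by simp
      then show ?thesis by blast
    qed
    moreover have "snd ` p division_of (cbox u v)" using division_of_tagged_division[OF p(1)] by simp
    ultimately show ?thesis using approximable_on_division[of e "snd ` p" u v g] \<open>e > 0\<close> by (metis less_imp_le)
  qed
  then show ?thesis using integrable_uniform_limit[of u v g] by simp
qed (simp add: integrable_on_empty)

section \<open>Regulated functions along \<open>T\<close> and their integrals through the floor of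
  \<open>T\<close>\<close>

context unbounded_time_scale
begin

text \<open>If \<open>T\<close> accumulates at \<open>t\<close> from one side, closedness puts
  \<open>t\<close> in \<open>T\<close> and makes it dense on that side, so rd-continuity supplies
  the limit; otherwise any value is a limit.\<close>

lemma rd_continuous_imp_regulated_on:
  assumes "rd_continuous T f"
  shows "regulated_on T f"
  unfolding regulated_on_def
proof (intro allI conjI)
  fix t
  have in_T: "t \<in> T" if "t islimpt (T \<inter> X)" for X
    using that closed_T closed_limpt islimpt_subset[of t "T \<inter> X" T] by blast
  show "\<exists>l. (f \<longlongrightarrow> l) (at t within (T \<inter> {t<..}))"
  proof (cases "t islimpt (T \<inter> {t<..})")
    case True
    have "\<not> t < \<sigma> t"
    proof
      assume "t < \<sigma> t"
      then obtain s where "s \<in> T" "s > t" "dist s t < \<sigma> t - t"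
        using True unfolding islimpt_approachable by (metis Int_iff diff_gt_0_iff_gt greaterThan_iff)
      then show False using forward_jump_le[of s t] by (simp add: dist_real_def)
    qed
    then have "right_dense T t" using right_dense_iff forward_jump_ge[of t] in_T[OF True] by auto
    then show ?thesis using assms unfolding rd_continuous_def continuous_within
      by (meson Int_lower1 tendsto_within_subset)
  qed (metis tendsto_bot trivial_limit_within)
  show "\<exists>l. (f \<longlongrightarrow> l) (at t within (T \<inter> {..<t}))"
  proof (cases "t islimpt (T \<inter> {..<t})")
    case True
    have "left_dense T t"
    proof (rule ccontr)
      assume nd: "\<not> left_dense T t"
      obtain s where "s \<in> T" "s < t" using True unfolding islimpt_approachable by (metis Int_iff lessThan_iff zero_less_one)
      then obtain r where r: "r \<in> T" "r < t" "\<sigma> r = t" using backward_gap[OF in_T[OF True] _ _ nd] by blast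
      then obtain q where "q \<in> T" "q < t" "dist q t < t - r"
        using True unfolding islimpt_approachable by (metis Int_iff diff_gt_0_iff_gt lessThan_iff)
      then show False using forward_jump_le[of q r] r by (auto simp: dist_real_def)
    qed
    then show ?thesis using assms unfolding rd_continuous_def by blast
  qed (metis tendsto_bot trivial_limit_within)
qed

text \<open>On a gap \<open>[t, \<sigma> t)\<close> it is constantly \<open>t\<close>, so
  integrating \<open>h (tfloor x)\<close> over the gap gives graininess times \<open>h t\<close>,
  the contribution of a right-scattered point to the delta integral. Below all points of
  \<open>T\<close> the supremum is over the empty set and has no meaning; integration therefore
  starts at a point of \<open>T\<close>.\<close>

definition tfloor :: "real \<Rightarrow> real" where "tfloor x = Sup (T \<inter> {..x})"

lemma tfloor_le: "a \<in> T \<Longrightarrow> a \<le> x \<Longrightarrow> tfloor x \<le> x"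
  unfolding tfloor_def by (rule cSup_least) auto

lemma tfloor_ge: "a \<in> T \<Longrightarrow> a \<le> x \<Longrightarrow> a \<le> tfloor x"
  unfolding tfloor_def by (rule cSup_upper) (auto intro!: bdd_aboveI[of _ x])

lemma tfloor_in:
  assumes "a \<in> T" "a \<le> x"
  shows "tfloor x \<in> T"
proof -
  have "tfloor x \<in> closure (T \<inter> {..x})"
    unfolding tfloor_def using assms by (intro closure_contains_Sup) (auto intro!: bdd_aboveI[of _ x])
  also have "\<dots> = T \<inter> {..x}" using closed_T by (intro closure_closed closed_Int) auto
  finally show ?thesis by simp
qed

lemma tfloor_eq: "a \<in> T \<Longrightarrow> a \<le> x \<Longrightarrow> (\<And>s. s \<in> T \<Longrightarrow> s \<le> x \<Longrightarrow> s \<le> a) \<Longrightarrow> tfloor x = a"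
  using tfloor_in[of a x] tfloor_le[of a x] tfloor_ge[of a x] by (intro antisym) auto

lemma tfloor_integrable:
  fixes h :: "real \<Rightarrow> 'a::banach"
  assumes h: "regulated_on T h" and u: "u \<in> T"
  shows "(\<lambda>x. h (tfloor x)) integrable_on {u..v}"
proof (rule regulated_integrable)
  fix x assume x: "x \<in> {u..v}"
  show "\<exists>l. ((\<lambda>x. h (tfloor x)) \<longlongrightarrow> l) (at_right x)"
  \<comment> \<open>Either \<open>T\<close> leaves an interval to the right of \<open>x\<close>
    free, where \<open>tfloor\<close> is constant, or it accumulates at \<open>x\<close> from the
    right; then \<open>tfloor z\<close> tends to \<open>x\<close> through points of \<open>T\<close>
    other than \<open>x\<close>, and the one-sided limit of \<open>h\<close> applies.\<close>
  proof (cases "\<exists>y>x. T \<inter> {x<..<y} = {}")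
    case True
    then obtain y where y: "y > x" "T \<inter> {x<..<y} = {}" by blast
    have "tfloor z = tfloor x" if "x < z" "z < y" for z
    proof (rule tfloor_eq)
      show "tfloor x \<in> T" "tfloor x \<le> z" using tfloor_in[OF u] tfloor_le[OF u] x that by force+
      fix s assume s: "s \<in> T" "s \<le> z"
      then have "s \<notin> {x<..<y}" using y(2) by blast
      then have "s \<le> x" using s that by simp
      then show "s \<le> tfloor x" using s tfloor_ge by simp
    qed
    then have "eventually (\<lambda>z. h (tfloor z) = h (tfloor x)) (at_right x)"
      by (intro eventually_at_rightI[OF _ y(1)]) simp
    then show ?thesis by (intro exI[of _ "h (tfloor x)"] tendsto_eventually)
  next
    case False
    have ev: "eventually (\<lambda>z. tfloor z \<in> T \<inter> {x<..} \<and> x \<le> tfloor z \<and> tfloor z \<le> z) (at_right x)"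
    proof -
      have "tfloor z \<in> T \<inter> {x<..} \<and> x \<le> tfloor z \<and> tfloor z \<le> z" if "x < z" for z
      proof -
        have "T \<inter> {x<..<z} \<noteq> {}" using False that by blast
        then obtain s where "s \<in> T" "x < s" "s < z" by auto
        then show ?thesis using tfloor_ge[of s z] tfloor_le[of s z] tfloor_in[of s z] by auto
      qed
      then show ?thesis by (simp add: eventually_at_filter)
    qed
    have "(tfloor \<longlongrightarrow> x) (at_right x)"
    proof (rule tendsto_sandwich[of "\<lambda>_. x" _ _ "\<lambda>z. z"])
      show "eventually (\<lambda>z. x \<le> tfloor z) (at_right x)" "eventually (\<lambda>z. tfloor z \<le> z) (at_right x)"
        using ev by (auto elim: eventually_mono)
    qed auto
    then have lim: "filterlim tfloor (at x within (T \<inter> {x<..})) (at_right x)"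
      unfolding filterlim_at using ev by (auto elim!: eventually_mono)
    obtain l where "(h \<longlongrightarrow> l) (at x within (T \<inter> {x<..}))" using h unfolding regulated_on_def by blast
    then show ?thesis by (intro exI[of _ l]) (rule filterlim_compose[OF _ lim])
  qed
  show "\<exists>l. ((\<lambda>x. h (tfloor x)) \<longlongrightarrow> l) (at x within {u..<x})"
  proof (cases "\<exists>y<x. T \<inter> {y<..<x} = {}")
    case True
    then obtain y where y: "y < x" "T \<inter> {y<..<x} = {}" by blast
    show ?thesis
    proof (cases "u < x")
      case True
      \<comment> \<open>The free interval may begin left of \<open>u\<close>, where
        \<open>tfloor\<close> is not under control; it is cut off there.\<close>
      define y' where "y' = max u y"
      have y': "y' < x" "y' \<ge> u" "y' \<ge> y" using True y by (auto simp: y'_def)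
      have "tfloor z = tfloor y'" if "y' < z" "z < x" for z
      proof (rule tfloor_eq)
        show "tfloor y' \<in> T" "tfloor y' \<le> z" using tfloor_in[OF u] tfloor_le[OF u] y' that by force+
        fix s assume s: "s \<in> T" "s \<le> z"
        then have "s \<notin> {y<..<x}" using y(2) by blast
        then have "s \<le> y'" using s that y' by simp
        then show "s \<le> tfloor y'" using s tfloor_ge by simp
      qed
      then have "eventually (\<lambda>z. h (tfloor z) = h (tfloor y')) (at_left x)"
        by (intro eventually_at_leftI[OF _ y'(1)]) simp
      then have "((\<lambda>x. h (tfloor x)) \<longlongrightarrow> h (tfloor y')) (at_left x)"
        by (rule tendsto_eventually)
      moreover have "{u..<x} \<subseteq> {..<x}" by (rule subsetI) simp
      ultimately have "((\<lambda>x. h (tfloor x)) \<longlongrightarrow> h (tfloor y')) (at x within {u..<x})"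
        by (rule tendsto_within_subset)
      then show ?thesis by (rule exI)
    next
      case False
      then have "{u..<x} = {}" by simp
      then show ?thesis by simp
    qed
  next
    case False
    have ev: "eventually (\<lambda>z. tfloor z \<in> T \<inter> {..<x} \<and> tfloor z \<le> z) (at x within {u..<x})"
    proof -
      have "tfloor z \<in> T \<inter> {..<x} \<and> tfloor z \<le> z" if "u \<le> z" "z < x" for z
        using tfloor_in[OF u, of z] tfloor_le[OF u, of z] that by auto
      then show ?thesis by (simp add: eventually_at_filter)
    qed
    have "(tfloor \<longlongrightarrow> x) (at x within {u..<x})"
      unfolding Lim_within
    proof (intro allI impI)
      fix e :: real assume "e > 0"
      then have "x - e < x" by simp
      then have "T \<inter> {x - e<..<x} \<noteq> {}" using False by blast
      then obtain s where s: "s \<in> T" "x - e < s" "s < x" by auto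
      have "dist (tfloor z) x < e" if "z \<in> {u..<x}" "dist z x < x - s" for z
        using that s tfloor_ge[OF s(1), of z] tfloor_le[OF s(1), of z] by (auto simp: dist_real_def)
      then show "\<exists>d>0. \<forall>z\<in>{u..<x}. 0 < dist z x \<and> dist z x < d \<longrightarrow> dist (tfloor z) x < e"
        using s by (intro exI[of _ "x - s"]) auto
    qed
    then have lim: "filterlim tfloor (at x within (T \<inter> {..<x})) (at x within {u..<x})"
      unfolding filterlim_at using ev by (auto elim!: eventually_mono)
    obtain l where "(h \<longlongrightarrow> l) (at x within (T \<inter> {..<x}))" using h unfolding regulated_on_def by blast
    then show ?thesis by (intro exI[of _ l]) (rule filterlim_compose[OF _ lim])
  qed
qed

text \<open>The right end \<open>v\<close> drops out of the bound as a single point. Taking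
  \<open>c = h t\<close> estimates difference quotients, and \<open>c = 0\<close> plain
  size.\<close>

lemma norm_integral_tfloor:
  fixes h :: "real \<Rightarrow> 'a::banach"
  assumes h: "regulated_on T h" and uv: "u \<in> T" "v \<in> T" "u \<le> v"
    and M: "M \<ge> 0" "\<And>r. r \<in> T \<Longrightarrow> u \<le> r \<Longrightarrow> r < v \<Longrightarrow> norm (h r - c) \<le> M"
  shows "norm (integral {u..v} (\<lambda>x. h (tfloor x)) - (v - u) *\<^sub>R c) \<le> M * (v - u)"
proof -
  have "((\<lambda>x. h (tfloor x) - c) has_integral integral {u..v} (\<lambda>x. h (tfloor x)) - (v - u) *\<^sub>R c) {u..v}"
    using tfloor_integrable[OF h uv(1), of v] has_integral_const_real[of c u v] uv
    by (intro has_integral_diff integrable_integral) auto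
  moreover have "norm (h (tfloor x) - c) \<le> M" if "x \<in> {u..v} - {v}" for x
    using that uv tfloor_in[of u x] tfloor_ge[of u x] tfloor_le[of u x] by (intro M) auto
  ultimately show ?thesis
    using has_integral_bound_spike_finite[of M "{v}" "\<lambda>x. h (tfloor x) - c" _ u v] M uv by simp
qed

text \<open>The integral over a gap is exactly graininess times \<open>h t\<close>, so
  right-scattered points always give the derivative, while the argument at a right-dense point rests
  on continuity of \<open>h\<close> there.\<close>

lemma delta_derivative_of_integral:
  fixes h F :: "real \<Rightarrow> 'a::banach"
  assumes h: "regulated_on T h"
    and F: "\<And>u v. u \<in> T \<Longrightarrow> v \<in> T \<Longrightarrow> u \<le> v \<Longrightarrow> F v - F u = integral {u..v} (\<lambda>x. h (tfloor x))"
  shows "continuous_on T F"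
    and "\<And>t. t \<in> T \<Longrightarrow> \<sigma> t = t \<Longrightarrow> continuous (at t within T) h \<Longrightarrow> has_delta_derivative T F (h t) t"
    and "\<And>t. t \<in> T \<Longrightarrow> \<sigma> t \<noteq> t \<Longrightarrow> has_delta_derivative T F (h t) t"
proof -
  have bound: "norm (F v - F u - (v - u) *\<^sub>R c) \<le> M * \<bar>v - u\<bar>"
    if "u \<in> T" "v \<in> T" "M \<ge> 0" and M: "\<And>r. r \<in> T \<Longrightarrow> min u v \<le> r \<Longrightarrow> r < max u v \<Longrightarrow> norm (h r - c) \<le> M" for u v c M
  proof (cases "u \<le> v")
    case True
    then show ?thesis using norm_integral_tfloor[OF h, of u v M c] F that by auto
  next
    case False
    then have "norm (F u - F v - (u - v) *\<^sub>R c) \<le> M * (u - v)"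
      using norm_integral_tfloor[OF h, of v u M c] F[of v u] that by auto
    also have "norm (F u - F v - (u - v) *\<^sub>R c) = norm (F v - F u - (v - u) *\<^sub>R c)"
      by (subst norm_minus_cancel[symmetric]) (simp add: algebra_simps)
    finally show ?thesis using False by simp
  qed
  have lip: "\<exists>d>0. \<exists>M>0. \<forall>s\<in>T. \<bar>s - t\<bar> < d \<longrightarrow> norm (F s - F t) \<le> M * \<bar>s - t\<bar>" if "t \<in> T" for t
  proof -
    obtain d M where "d > 0" "M > 0" and M: "\<And>s. s \<in> T \<Longrightarrow> \<bar>s - t\<bar> < d \<Longrightarrow> norm (h s) \<le> M"
      using regulated_on_locally_bounded[OF h] by metis
    have "norm (F s - F t) \<le> M * \<bar>s - t\<bar>" if "s \<in> T" "\<bar>s - t\<bar> < d" for s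
      using bound[of t s M 0] that \<open>t \<in> T\<close> \<open>M > 0\<close> by (force intro!: M)
    then show ?thesis using \<open>d > 0\<close> \<open>M > 0\<close> by blast
  qed
  have cont: "continuous (at t within T) F" if t: "t \<in> T" for t
    unfolding continuous_within_eps_delta
  proof (intro allI impI)
    fix e :: real assume "e > 0"
    obtain d M where dM: "d > 0" "M > 0" "\<forall>s\<in>T. \<bar>s - t\<bar> < d \<longrightarrow> norm (F s - F t) \<le> M * \<bar>s - t\<bar>"
      using lip[OF t] by blast
    have "norm (F s - F t) < e" if "s \<in> T" "\<bar>s - t\<bar> < min d (e / M)" for s
    proof -
      have "norm (F s - F t) \<le> M * \<bar>s - t\<bar>" using dM that by auto
      also have "\<dots> < e" using that dM by (simp add: field_simps)
      finally show ?thesis .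
    qed
    then show "\<exists>d>0. \<forall>x'\<in>T. dist x' t < d \<longrightarrow> dist (F x') (F t) < e"
      using dM \<open>e > 0\<close> by (intro exI[of _ "min d (e / M)"]) (auto simp: dist_norm)
  qed
  then show "continuous_on T F" using continuous_on_eq_continuous_within by blast
  show "has_delta_derivative T F (h t) t" if t: "t \<in> T" "\<sigma> t = t" "continuous (at t within T) h" for t
    unfolding has_delta_derivative_def t(2)
  proof (intro allI impI)
    fix e :: real assume "e > 0"
    then obtain d where d: "d > 0" "\<And>s. s \<in> T \<Longrightarrow> \<bar>s - t\<bar> < d \<Longrightarrow> norm (h s - h t) < e"
      using t(3) unfolding continuous_within_eps_delta by (auto simp: dist_norm)
    have "norm (F t - F s - (t - s) *\<^sub>R h t) \<le> e * \<bar>t - s\<bar>" if "s \<in> T" "\<bar>s - t\<bar> < d" for s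
      using that t \<open>e > 0\<close> by (intro bound) (auto intro!: less_imp_le[OF d(2)])
    then show "\<exists>d>0. \<forall>s\<in>T. \<bar>s - t\<bar> < d \<longrightarrow> norm (F t - F s - (t - s) *\<^sub>R h t) \<le> e * \<bar>t - s\<bar>"
      using d(1) by blast
  qed
  show "has_delta_derivative T F (h t) t" if t: "t \<in> T" "\<sigma> t \<noteq> t" for t
    unfolding has_delta_derivative_def
  proof (intro allI impI)
    fix e :: real assume "e > 0"
    define m where "m = \<sigma> t - t"
    have "m > 0" using t forward_jump_ge[of t] by (simp add: m_def)
    \<comment> \<open>The only point of \<open>T\<close> in \<open>[t, \<sigma> t)\<close> is
      \<open>t\<close>, so the deviation of \<open>h\<close> from \<open>h t\<close> is 0.\<close>
    have "norm (F (\<sigma> t) - F t - (\<sigma> t - t) *\<^sub>R h t) \<le> 0 * \<bar>\<sigma> t - t\<bar>"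
    proof (rule bound)
      fix r assume r: "r \<in> T" "min t (\<sigma> t) \<le> r" "r < max t (\<sigma> t)"
      then have "r = t" using forward_jump_le[of r t] forward_jump_ge[of t] by (cases "t < r") auto
      then show "norm (h r - h t) \<le> 0" by simp
    qed (use t forward_jump_in in auto)
    then have jump: "F (\<sigma> t) = F t + (\<sigma> t - t) *\<^sub>R h t" by (simp add: algebra_simps)
    have "continuous (at t within T) (\<lambda>s. F t - F s - (t - s) *\<^sub>R h t)"
      using cont[OF t(1)] by (intro continuous_intros)
    moreover have "e * m > 0" using \<open>e > 0\<close> \<open>m > 0\<close> by simp
    ultimately obtain d where d: "d > 0" "\<And>s. s \<in> T \<Longrightarrow> \<bar>s - t\<bar> < d \<Longrightarrow> norm (F t - F s - (t - s) *\<^sub>R h t) < e * m"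
      unfolding continuous_within_eps_delta by (force simp: dist_norm)
    \<comment> \<open>Within distance \<open>m\<close> of \<open>t\<close> all points of
      \<open>T\<close> lie at or before \<open>t\<close>, so \<open>\<sigma> t - s\<close> is at
      least \<open>m\<close>, and continuity of \<open>F\<close> with tolerance \<open>e * m\<close>
      is enough.\<close>
    have "norm (F (\<sigma> t) - F s - (\<sigma> t - s) *\<^sub>R h t) \<le> e * \<bar>\<sigma> t - s\<bar>" if s: "s \<in> T" "\<bar>s - t\<bar> < min d m" for s
    proof -
      have eq: "F (\<sigma> t) - F s - (\<sigma> t - s) *\<^sub>R h t = F t - F s - (t - s) *\<^sub>R h t"
        unfolding jump by (simp add: algebra_simps)
      have "s \<le> t" using s forward_jump_le[of s t] unfolding m_def by (cases "t < s") auto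
      then have "m \<le> \<bar>\<sigma> t - s\<bar>" unfolding m_def by auto
      then have "e * m \<le> e * \<bar>\<sigma> t - s\<bar>" using \<open>e > 0\<close> by simp
      then show ?thesis unfolding eq using d(2)[of s] s by linarith
    qed
    then show "\<exists>d>0. \<forall>s\<in>T. \<bar>s - t\<bar> < d \<longrightarrow> norm (F (\<sigma> t) - F s - (\<sigma> t - s) *\<^sub>R h t) \<le> e * \<bar>\<sigma> t - s\<bar>"
      using d(1) \<open>m > 0\<close> by (intro exI[of _ "min d m"]) auto
  qed
qed

end


section \<open>Linear equations\<close>

context unbounded_time_scale
begin

lemma left_dense_approx:
  assumes "left_dense T t" "y < t"
  shows "\<exists>s\<in>T. y < s \<and> s < t"
proof -
  have ex: "\<exists>s\<in>T. s < t" and "backward_jump T t = t" using assms by (auto simp: left_dense_def)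
  then have "y < Sup {s\<in>T. s < t}" "{s\<in>T. s < t} \<noteq> {}"
    using assms(2) by (auto simp: backward_jump_def)
  then show ?thesis using less_cSupD[of "{s\<in>T. s < t}" y] by auto
qed

lemma compact_zeros:
  fixes z :: "real \<Rightarrow> 'a::real_normed_vector"
  assumes "continuous_on T z"
  shows "compact {s \<in> T \<inter> {a..b}. z s = 0}"
proof -
  have "continuous_on (T \<inter> {a..b}) z" using assms by (rule continuous_on_subset) auto
  then have "closed (T \<inter> {a..b} \<inter> z -` {0})" using closed_T by (intro continuous_closed_preimage) auto
  also have "T \<inter> {a..b} \<inter> z -` {0} = {s \<in> T \<inter> {a..b}. z s = 0}" by auto
  finally have "closed {s \<in> T \<inter> {a..b}. z s = 0}" .
  moreover have "bounded {s \<in> T \<inter> {a..b}. z s = 0}" by (rule bounded_subset[of "{a..b}"]) auto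
  ultimately show ?thesis by (simp add: compact_eq_bounded_closed)
qed

text \<open>At a point \<open>m\<close> where the norm is maximal, the mean value inequality between
  \<open>m\<close> and the zero \<open>c\<close> bounds \<open>norm (z m)\<close> by half of itself;
  the length \<open>1 / (2 * M * K)\<close> produces the factor one half. As \<open>c\<close> may
  sit at either end, the lemma serves both directions, and the abstract \<open>bil\<close> treats
  vector and matrix equations at once.\<close>

lemma linear_zero_local:
  fixes bil :: "'b::real_normed_vector \<Rightarrow> 'a::real_normed_vector \<Rightarrow> 'a"
  assumes der: "\<And>t. t \<in> T \<Longrightarrow> has_delta_derivative T z (bil (A t) (z t)) t"
    and K: "\<And>a x. norm (bil a x) \<le> norm a * norm x * K" "K > 0"
    and M: "\<And>t. t \<in> T \<Longrightarrow> u \<le> t \<Longrightarrow> t < v \<Longrightarrow> norm (A t) \<le> M" "M > 0"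
    and small: "v - u < 1 / (2 * M * K)"
    and c: "c \<in> T" "u \<le> c" "c \<le> v" "z c = 0"
    and w: "w \<in> T" "u \<le> w" "w \<le> v"
  shows "z w = 0"
proof -
  have cont: "continuous_on T z" using der by (rule has_delta_derivative_continuous_on)
  then have "continuous_on (T \<inter> {u..v}) (\<lambda>t. norm (z t))"
    by (intro continuous_on_norm) (rule continuous_on_subset, auto)
  moreover have "compact (T \<inter> {u..v})" using closed_T by (simp add: closed_Int_compact)
  moreover have "T \<inter> {u..v} \<noteq> {}" using c by auto
  ultimately obtain m where m: "m \<in> T \<inter> {u..v}" "\<And>t. t \<in> T \<inter> {u..v} \<Longrightarrow> norm (z t) \<le> norm (z m)"
    using continuous_attains_sup[of "T \<inter> {u..v}" "\<lambda>t. norm (z t)"] by blast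
  define C where "C = M * norm (z m) * K"
  have bound: "norm (z q - z r) \<le> C * (q - r)" if "q \<in> T" "r \<in> T" "u \<le> r" "r \<le> q" "q \<le> v" for q r
  proof (rule delta_mean_value[OF cont, of r q "{}"])
    fix t assume t: "t \<in> T" "r \<le> t" "t < q"
    have "norm (bil (A t) (z t)) \<le> norm (A t) * norm (z t) * K" by (rule K)
    also have "\<dots> \<le> C" unfolding C_def using t that K(2) M(2)
      by (intro mult_right_mono mult_mono M m(2)) auto
    finally show "\<exists>D. has_delta_derivative T z D t \<and> norm D \<le> C" using der t by blast
  qed (use that in auto)
  have "norm (z m) \<le> C * \<bar>m - c\<bar>"
    using bound[of m c] bound[of c m] c m(1) by (cases "c \<le> m") (auto simp: norm_minus_commute)
  also have "\<dots> \<le> C * (1 / (2 * M * K))"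
    using m(1) c small K(2) M(2) by (intro mult_left_mono) (auto simp: C_def)
  also have "\<dots> = norm (z m) / 2" using K(2) M(2) by (simp add: C_def)
  finally have "norm (z m) = 0" by simp
  then show ?thesis using m(2)[of w] w by simp
qed

text \<open>Suppose the last zero \<open>m\<close> in \<open>[a, b]\<close> came before
  \<open>b\<close>. If it is right-dense, the local lemma produces a later zero; if it is
  right-scattered, the jump formula gives \<open>z (\<sigma> m) = z m = 0\<close>.\<close>

lemma linear_zero_forward:
  fixes bil :: "'b::real_normed_vector \<Rightarrow> 'a::real_normed_vector \<Rightarrow> 'a"
  assumes bil: "bounded_bilinear bil" and A: "regulated_on T A"
    and der: "\<And>t. t \<in> T \<Longrightarrow> has_delta_derivative T z (bil (A t) (z t)) t"
    and a: "a \<in> T" "z a = 0" and b: "b \<in> T" "a \<le> b"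
  shows "z b = 0"
proof (rule ccontr)
  assume nz: "z b \<noteq> 0"
  interpret bounded_bilinear bil by (rule bil)
  obtain K where K: "K > 0" "\<And>a x. norm (bil a x) \<le> norm a * norm x * K" using pos_bounded by blast
  define S where "S = {s \<in> T \<inter> {a..b}. z s = 0}"
  have "compact S" unfolding S_def by (rule compact_zeros[OF has_delta_derivative_continuous_on[OF der]])
  moreover have "a \<in> S" using a b by (simp add: S_def)
  ultimately obtain m where m: "m \<in> S" "\<And>t. t \<in> S \<Longrightarrow> t \<le> m" using compact_attains_sup[of S] by blast
  then have mT: "m \<in> T" "a \<le> m" "m \<le> b" "z m = 0" by (auto simp: S_def)
  then have "m < b" using nz by (cases "m = b") auto
  show False
  proof (cases "\<sigma> m = m")
    case True
    obtain d M where dM: "d > 0" "M > 0" "\<And>s. s \<in> T \<Longrightarrow> \<bar>s - m\<bar> < d \<Longrightarrow> norm (A s) \<le> M"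
      using regulated_on_locally_bounded[OF A] by metis
    obtain v where v: "v \<in> T" "m < v" "v < Min {b, m + d, m + 1 / (2 * M * K)}"
      using forward_jump_less_imp[of m "Min {b, m + d, m + 1 / (2 * M * K)}"] True \<open>m < b\<close> dM(1,2) K(1)
      by auto
    have "z v = 0"
      by (rule linear_zero_local[OF der K(2,1), where c = m and u = m and v = v and M = M])
        (use v mT dM in auto)
    then have "v \<in> S" using v mT by (auto simp: S_def)
    then show False using m(2)[of v] v by simp
  next
    case False
    then have s: "\<sigma> m \<in> T" "m < \<sigma> m" "\<sigma> m \<le> b"
      using forward_jump_in forward_jump_ge[of m] forward_jump_le[of b m] mT \<open>m < b\<close> b by auto
    have "z (\<sigma> m) = 0" using has_delta_derivative_jump[OF der[OF mT(1)] mT(1)] mT zero_right by simp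
    then have "\<sigma> m \<in> S" using s mT by (auto simp: S_def)
    then show False using m(2)[of "\<sigma> m"] s by simp
  qed
qed

text \<open>Mirror image with the first zero \<open>m\<close>. If \<open>m\<close> is not
  left-dense, it is \<open>\<sigma> r\<close> for some \<open>r\<close> in \<open>T\<close>, and the
  equation at \<open>r\<close> reads
  \<open>z r + (\<sigma> r - r) *\<^sub>R bil (A r) (z r) = 0\<close>. Undoing this step is where
  regressivity enters, in the form of \<open>inj\<close>.\<close>

lemma linear_zero_backward:
  fixes bil :: "'b::real_normed_vector \<Rightarrow> 'a::real_normed_vector \<Rightarrow> 'a"
  assumes bil: "bounded_bilinear bil" and A: "regulated_on T A"
    and inj: "\<And>t x. t \<in> T \<Longrightarrow> x + (\<sigma> t - t) *\<^sub>R bil (A t) x = 0 \<Longrightarrow> x = 0"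
    and der: "\<And>t. t \<in> T \<Longrightarrow> has_delta_derivative T z (bil (A t) (z t)) t"
    and a: "a \<in> T" "z a = 0" and b: "b \<in> T" "b \<le> a"
  shows "z b = 0"
proof (rule ccontr)
  assume nz: "z b \<noteq> 0"
  interpret bounded_bilinear bil by (rule bil)
  obtain K where K: "K > 0" "\<And>a x. norm (bil a x) \<le> norm a * norm x * K" using pos_bounded by blast
  define S where "S = {s \<in> T \<inter> {b..a}. z s = 0}"
  have "compact S" unfolding S_def by (rule compact_zeros[OF has_delta_derivative_continuous_on[OF der]])
  moreover have "a \<in> S" using a b by (simp add: S_def)
  ultimately obtain m where m: "m \<in> S" "\<And>t. t \<in> S \<Longrightarrow> m \<le> t" using compact_attains_inf[of S] by blast
  then have mT: "m \<in> T" "b \<le> m" "m \<le> a" "z m = 0" by (auto simp: S_def)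
  then have "b < m" using nz by (cases "m = b") auto
  show False
  proof (cases "left_dense T m")
    case True
    obtain d M where dM: "d > 0" "M > 0" "\<And>s. s \<in> T \<Longrightarrow> \<bar>s - m\<bar> < d \<Longrightarrow> norm (A s) \<le> M"
      using regulated_on_locally_bounded[OF A] by metis
    obtain v where v: "v \<in> T" "v < m" "v > Max {b, m - d, m - 1 / (2 * M * K)}"
      using left_dense_approx[OF True, of "Max {b, m - d, m - 1 / (2 * M * K)}"] \<open>b < m\<close> dM(1,2) K(1)
      by auto
    have "z v = 0"
      by (rule linear_zero_local[OF der K(2,1), where c = m and u = v and v = m and M = M])
        (use v mT dM in auto)
    then have "v \<in> S" using v mT by (auto simp: S_def)
    then show False using m(2)[of v] v by simp
  next
    case False
    obtain r where r: "r \<in> T" "b \<le> r" "r < m" "\<sigma> r = m"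
      using backward_gap[OF mT(1) b(1) \<open>b < m\<close> False] by blast
    have "z m - z r = (\<sigma> r - r) *\<^sub>R bil (A r) (z r)" using has_delta_derivative_jump[OF der[OF r(1)] r(1)] r(4) by simp
    then have "z r + (\<sigma> r - r) *\<^sub>R bil (A r) (z r) = 0" using mT(4) by (metis add.commute diff_add_cancel)
    then have "z r = 0" using inj r(1) by blast
    then have "r \<in> S" using r mT by (auto simp: S_def)
    then show False using m(2)[of r] r by simp
  qed
qed

lemma continuous_on_imp_regulated_on:
  assumes "continuous_on T f"
  shows "regulated_on T f"
proof -
  have "(f \<longlongrightarrow> f t) (at t within (T \<inter> X))" for t X
  proof (cases "t \<in> T")
    case True
    then have "(f \<longlongrightarrow> f t) (at t within T)" using assms continuous_on by blast
    then show ?thesis by (rule tendsto_within_subset) simp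
  next
    case False
    then have "\<not> t islimpt (T \<inter> X)" using closed_T closed_limpt islimpt_subset[of t "T \<inter> X" T] by blast
    then show ?thesis by (metis tendsto_bot trivial_limit_within)
  qed
  then show ?thesis unfolding regulated_on_def by blast
qed

lemma integral_tfloor_split:
  fixes h :: "real \<Rightarrow> 'a::banach"
  assumes "regulated_on T h" "a \<in> T" "a \<le> u" "u \<le> v"
  shows "integral {a..v} (\<lambda>x. h (tfloor x)) - integral {a..u} (\<lambda>x. h (tfloor x)) = integral {u..v} (\<lambda>x. h (tfloor x))"
  using Henstock_Kurzweil_Integration.integral_combine[OF assms(3,4) tfloor_integrable[OF assms(1,2)]]
  by (simp add: algebra_simps)

end

text \<open>With a least point every integral can start at \<open>a\<close>, and Picard iteration
  only has to run forward. Half-lines of a general time scale are of this kind.\<close>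

locale initial_time_scale = unbounded_time_scale +
  fixes a :: real
  assumes a_in: "a \<in> T" and a_least: "t \<in> T \<Longrightarrow> a \<le> t"
begin

text \<open>Picard iteration in series form: \<open>X n\<close> is the n-fold iterated integral
  applied to the constant \<open>x0\<close>. A factorial bound gives locally uniform convergence,
  the sum satisfies the integral equation, and this is then differentiated.\<close>

lemma linear_solution_exists:
  fixes bil :: "'b::real_normed_vector \<Rightarrow> 'a::banach \<Rightarrow> 'a" and x0 :: 'a
  assumes bil: "bounded_bilinear bil" and A: "rd_continuous T A"
  obtains x where "x a = x0" "\<And>t. t \<in> T \<Longrightarrow> has_delta_derivative T x (bil (A t) (x t)) t"
proof -
  interpret bil: bounded_bilinear bil by (rule bil)
  obtain K where K: "K > 0" "\<And>a x. norm (bil a x) \<le> norm a * norm x * K" using bil.pos_bounded by blast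
  have regA: "regulated_on T A" using A by (rule rd_continuous_imp_regulated_on)
  define X where "X = rec_nat (\<lambda>_. x0) (\<lambda>_ f t. integral {a..t} (\<lambda>s. bil (A (tfloor s)) (f (tfloor s))))"
  have X0: "X 0 t = x0" and XS: "X (Suc n) t = integral {a..t} (\<lambda>s. bil (A (tfloor s)) (X n (tfloor s)))" for n t
    by (simp_all add: X_def)
  have reg: "regulated_on T (\<lambda>t. bil (A t) (f t))" if "continuous_on T f" for f
    using regulated_on_bounded_bilinear[OF bil regA continuous_on_imp_regulated_on[OF that]] .
  have split: "integral {a..v} (\<lambda>s. bil (A (tfloor s)) (f (tfloor s))) - integral {a..u} (\<lambda>s. bil (A (tfloor s)) (f (tfloor s)))
      = integral {u..v} (\<lambda>s. bil (A (tfloor s)) (f (tfloor s)))"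
    if "continuous_on T f" "u \<in> T" "v \<in> T" "u \<le> v" for f u v
    using integral_tfloor_split[OF reg[OF that(1)] a_in a_least[OF that(2)] that(4)] .
  have X_cont: "continuous_on T (X n)" for n
  proof (induction n)
    case 0
    then show ?case using X0 by (simp add: X_def)
  next
    case (Suc n)
    show ?case
      by (rule delta_derivative_of_integral(1)[OF reg[OF Suc]]) (simp add: XS split[OF Suc])
  qed
  have X_int: "(\<lambda>s. bil (A (tfloor s)) (X n (tfloor s))) integrable_on {a..t}" for n t
    by (rule tfloor_integrable[OF reg[OF X_cont] a_in])
  have X_bound: "norm (X n t) \<le> norm x0 * (M * K * (t - a)) ^ n / fact n"
    if M: "M > 0" "\<And>s. s \<in> T \<Longrightarrow> a \<le> s \<Longrightarrow> s \<le> b \<Longrightarrow> norm (A s) \<le> M" and t: "a \<le> t" "t \<le> b" "t \<in> T" for M b n t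
    using t
  proof (induction n arbitrary: t)
    case 0
    then show ?case by (simp add: X0)
  next
    case (Suc n)
    define c where "c = M * K * norm x0 * (M * K) ^ n / fact n"
    have "((\<lambda>s. c * (s - a) ^ n) has_integral c * (t - a) ^ Suc n / Suc n - c * (a - a) ^ Suc n / Suc n) {a..t}"
    proof (rule fundamental_theorem_of_calculus[OF Suc.prems(1)])
      fix s
      have "((\<lambda>s. c * (s - a) ^ Suc n / Suc n) has_field_derivative c * (s - a) ^ n) (at s within {a..t})"
        by (auto intro!: derivative_eq_intros simp: field_simps simp del: power_Suc of_nat_Suc)
      then show "((\<lambda>s. c * (s - a) ^ Suc n / Suc n) has_vector_derivative c * (s - a) ^ n) (at s within {a..t})"
        by (simp add: has_real_derivative_iff_has_vector_derivative)
    qed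
    then have int: "((\<lambda>s. c * (s - a) ^ n) has_integral c * (t - a) ^ Suc n / Suc n) {a..t}" by simp
    have "norm (X (Suc n) t) \<le> integral {a..t} (\<lambda>s. c * (s - a) ^ n)"
      unfolding XS
    proof (rule integral_norm_bound_integral[OF X_int])
      show "(\<lambda>s. c * (s - a) ^ n) integrable_on {a..t}" using int by blast
      fix s assume "s \<in> {a..t}"
      then have s: "tfloor s \<in> T" "a \<le> tfloor s" "tfloor s \<le> s" "s \<le> t"
        using tfloor_in[OF a_in] tfloor_ge[OF a_in] tfloor_le[OF a_in] by auto
      have "norm (bil (A (tfloor s)) (X n (tfloor s))) \<le> norm (A (tfloor s)) * norm (X n (tfloor s)) * K" by (rule K)
      also have "\<dots> \<le> M * (norm x0 * (M * K * (tfloor s - a)) ^ n / fact n) * K"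
        using s Suc.prems K(1) M(1) by (intro mult_right_mono mult_mono Suc.IH M(2)) auto
      \<comment> \<open>Since \<open>tfloor s \<le> s\<close>, passing to \<open>s\<close> only
        enlarges the bound, and it leaves a polynomial for the fundamental theorem of
        calculus.\<close>
      also have "\<dots> \<le> M * (norm x0 * (M * K * (s - a)) ^ n / fact n) * K"
        using s K(1) M(1) by (intro mult_right_mono mult_left_mono divide_right_mono power_mono) auto
      also have "\<dots> = c * (s - a) ^ n" by (simp add: c_def power_mult_distrib)
      finally show "norm (bil (A (tfloor s)) (X n (tfloor s))) \<le> c * (s - a) ^ n" .
    qed
    also have "\<dots> = c * (t - a) ^ Suc n / Suc n" using int by (rule integral_unique)
    also have "\<dots> = norm x0 * (M * K * (t - a)) ^ Suc n / fact (Suc n)"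
      by (simp add: c_def power_mult_distrib mult_ac)
    finally show ?case .
  qed
  define x where "x t = (\<Sum>n. X n t)" for t
  have unif: "uniform_limit (T \<inter> {a..b}) (\<lambda>n t. \<Sum>i<n. X i t) x sequentially" for b
  proof -
    obtain M where M: "M > 0" "\<And>s. s \<in> T \<Longrightarrow> a \<le> s \<Longrightarrow> s \<le> b \<Longrightarrow> norm (A s) \<le> M"
      using regulated_on_bounded[OF regA] by metis
    show ?thesis unfolding x_def
    proof (rule Weierstrass_m_test)
      show "norm (X n t) \<le> norm x0 * (inverse (fact n) * (M * K * (b - a)) ^ n)" if "t \<in> T \<inter> {a..b}" for n t
      proof -
        have "norm (X n t) \<le> norm x0 * (M * K * (t - a)) ^ n / fact n"
          using X_bound[OF M, of b t n] that by auto
        also have "\<dots> \<le> norm x0 * (M * K * (b - a)) ^ n / fact n"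
          using that K(1) M(1) by (intro divide_right_mono mult_left_mono power_mono) auto
        finally show ?thesis by (simp add: divide_inverse mult_ac)
      qed
      show "summable (\<lambda>n. norm x0 * (inverse (fact n) * (M * K * (b - a)) ^ n))"
        by (intro summable_mult summable_exp)
    qed
  qed
  have x_cont: "continuous_on T x"
  proof -
    have "continuous_on (T \<inter> {a..b}) x" for b
    proof (rule uniform_limit_theorem[OF _ unif])
      show "\<forall>\<^sub>F n in sequentially. continuous_on (T \<inter> {a..b}) (\<lambda>t. \<Sum>i<n. X i t)"
        by (intro always_eventually allI continuous_on_sum) (meson X_cont continuous_on_subset Int_lower1)
    qed simp
    then have "continuous (at t within T \<inter> {a..t + 1}) x" if "t \<in> T" for t
      using that a_least[OF that] by (simp add: continuous_on_eq_continuous_within)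
    \<comment> \<open>Convergence is uniform on bounded parts only, but continuity at
      \<open>t\<close> sees no more than the part below \<open>t + 1\<close>.\<close>
    moreover have "at t within T \<inter> {a..t + 1} = at t within T" for t
      by (rule at_within_nhd[of _ "{..<t + 1}"]) (auto simp: a_least)
    ultimately show ?thesis by (simp add: continuous_on_eq_continuous_within)
  qed
  have x_eq: "x t = x0 + integral {a..t} (\<lambda>s. bil (A (tfloor s)) (x (tfloor s)))" if t: "t \<in> T" for t
  proof -
    obtain M where M: "M > 0" "\<And>s. s \<in> T \<Longrightarrow> a \<le> s \<Longrightarrow> s \<le> t \<Longrightarrow> norm (A s) \<le> M"
      using regulated_on_bounded[OF regA] by metis
    let ?I = "integral {a..t} (\<lambda>s. bil (A (tfloor s)) (x (tfloor s)))"
    let ?S = "\<lambda>n t. \<Sum>i<n. X i t"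
    have S_cont: "continuous_on T (?S n)" for n by (intro continuous_on_sum X_cont)
    have S_eq: "?S (Suc n) t = x0 + integral {a..t} (\<lambda>s. bil (A (tfloor s)) (?S n (tfloor s)))" for n
    proof -
      have "?S (Suc n) t = x0 + (\<Sum>i<n. X (Suc i) t)" by (simp add: sum.lessThan_Suc_shift X0 del: sum.lessThan_Suc)
      also have "(\<Sum>i<n. X (Suc i) t) = integral {a..t} (\<lambda>s. \<Sum>i<n. bil (A (tfloor s)) (X i (tfloor s)))"
        unfolding XS using X_int by (simp add: integral_sum)
      finally show ?thesis by (simp add: bil.sum_right)
    qed
    have "(\<lambda>n. ?S (Suc n) t) \<longlonglongrightarrow> x0 + ?I"
    proof (rule LIMSEQ_I)
      fix e :: real assume "e > 0"
      \<comment> \<open>The 1 avoids a division by 0 when \<open>t = a\<close>;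
        \<open>\<eta>\<close> is chosen to make the final bound \<open>e / 2\<close>.\<close>
      define L where "L = t - a + 1"
      define \<eta> where "\<eta> = e / (2 * M * K * L)"
      have pos: "L > 0" using a_least[OF t] by (simp add: L_def)
      then have "\<eta> > 0" using \<open>e > 0\<close> K(1) M(1) by (simp add: \<eta>_def)
      then have "\<forall>\<^sub>F n in sequentially. \<forall>s\<in>T \<inter> {a..t}. dist (?S n s) (x s) < \<eta>"
        using unif[of t] by (simp add: uniform_limit_iff)
      then obtain N where N: "\<And>n s. n \<ge> N \<Longrightarrow> s \<in> T \<inter> {a..t} \<Longrightarrow> norm (?S n s - x s) < \<eta>"
        unfolding eventually_sequentially dist_norm by blast
      have "norm (?S (Suc n) t - (x0 + ?I)) < e" if "n \<ge> N" for n
      proof -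
        have "continuous_on T (\<lambda>s. ?S n s - x s)" using S_cont[of n] x_cont by (rule continuous_on_diff)
        note reg' = reg[OF this]
        have "?S (Suc n) t - (x0 + ?I) = integral {a..t} (\<lambda>s. bil (A (tfloor s)) (?S n (tfloor s))) - ?I"
          unfolding S_eq by simp
        also have "\<dots> = integral {a..t} (\<lambda>s. bil (A (tfloor s)) (?S n (tfloor s)) - bil (A (tfloor s)) (x (tfloor s)))"
          by (rule integral_diff[symmetric]) (intro tfloor_integrable[OF reg[OF S_cont] a_in] tfloor_integrable[OF reg[OF x_cont] a_in])+
        also have "\<dots> = integral {a..t} (\<lambda>s. bil (A (tfloor s)) (?S n (tfloor s) - x (tfloor s)))"
          by (simp add: bil.diff_right)
        also have "norm \<dots> \<le> M * \<eta> * K * (t - a)"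
        proof -
          have "norm (bil (A r) (?S n r - x r)) \<le> M * \<eta> * K" if r: "r \<in> T" "a \<le> r" "r < t" for r
          proof -
            have "norm (bil (A r) (?S n r - x r)) \<le> norm (A r) * norm (?S n r - x r) * K" by (rule K)
            also have "\<dots> \<le> M * \<eta> * K"
              using r K(1) M(1) N[OF \<open>n \<ge> N\<close>, of r] by (intro mult_right_mono mult_mono M(2)) (auto intro: less_imp_le)
            finally show ?thesis .
          qed
          then show ?thesis
            using norm_integral_tfloor[OF reg' a_in t a_least[OF t], of "M * \<eta> * K" 0] K(1) M(1) \<open>\<eta> > 0\<close> by simp
        qed
        also have "\<dots> \<le> M * \<eta> * K * L"
          using K(1) M(1) \<open>\<eta> > 0\<close> by (intro mult_left_mono) (auto simp: L_def)
        also have "\<dots> = e / 2" using K(1) M(1) pos by (simp add: \<eta>_def)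
        finally show ?thesis using \<open>e > 0\<close> by simp
      qed
      then show "\<exists>N. \<forall>n\<ge>N. norm (?S (Suc n) t - (x0 + ?I)) < e" by blast
    qed
    moreover have "(\<lambda>n. ?S (Suc n) t) \<longlonglongrightarrow> x t"
    proof -
      have "(\<lambda>n. ?S n t) \<longlonglongrightarrow> x t" using tendsto_uniform_limitI[OF unif[of t]] t a_least[OF t] by auto
      then show ?thesis by (rule LIMSEQ_Suc)
    qed
    ultimately show ?thesis using LIMSEQ_unique by blast
  qed
  have x_diff: "x v - x u = integral {u..v} (\<lambda>s. bil (A (tfloor s)) (x (tfloor s)))" if "u \<in> T" "v \<in> T" "u \<le> v" for u v
    using split[OF x_cont that] x_eq[OF that(1)] x_eq[OF that(2)] by simp
  show thesis
  proof (rule that)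
    show "x a = x0" using x_eq[OF a_in] by simp
    fix t assume t: "t \<in> T"
    show "has_delta_derivative T x (bil (A t) (x t)) t"
    proof (cases "\<sigma> t = t")
      case True
      then have "continuous (at t within T) A" using A t right_dense_iff by (auto simp: rd_continuous_def)
      moreover have "continuous (at t within T) x" using x_cont t continuous_on_eq_continuous_within by blast
      ultimately have "continuous (at t within T) (\<lambda>t. bil (A t) (x t))" by (rule bil.continuous)
      then show ?thesis using delta_derivative_of_integral(2)[OF reg[OF x_cont], of x t] x_diff t True by simp
    next
      case False
      then show ?thesis using delta_derivative_of_integral(3)[OF reg[OF x_cont], of x t] x_diff t by simp
    qed
  qed
qed

end


section \<open>Transition matrices\<close>

lemma has_delta_derivative_linear:
  assumes "bounded_linear L" "has_delta_derivative T F D t"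
  shows "has_delta_derivative T (\<lambda>s. L (F s)) (L D) t"
  unfolding has_delta_derivative_def
proof (intro allI impI)
  fix e :: real assume "e > 0"
  interpret L: bounded_linear L by (rule assms(1))
  obtain B where B: "B > 0" "\<And>x. norm (L x) \<le> norm x * B" using L.pos_bounded by blast
  then have "e / B > 0" using \<open>e > 0\<close> by simp
  then obtain d where d: "d > 0" "\<forall>s\<in>T. \<bar>s - t\<bar> < d \<longrightarrow>
      norm (F (forward_jump T t) - F s - (forward_jump T t - s) *\<^sub>R D) \<le> e / B * \<bar>forward_jump T t - s\<bar>"
    using assms(2) unfolding has_delta_derivative_def by blast
  have "norm (L (F (forward_jump T t)) - L (F s) - (forward_jump T t - s) *\<^sub>R L D) \<le> e * \<bar>forward_jump T t - s\<bar>"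
    if "s \<in> T" "\<bar>s - t\<bar> < d" for s
  proof -
    have "norm (L (F (forward_jump T t)) - L (F s) - (forward_jump T t - s) *\<^sub>R L D)
        = norm (L (F (forward_jump T t) - F s - (forward_jump T t - s) *\<^sub>R D))"
      by (simp add: L.diff L.scaleR)
    also have "\<dots> \<le> norm (F (forward_jump T t) - F s - (forward_jump T t - s) *\<^sub>R D) * B" by (rule B)
    also have "\<dots> \<le> e / B * \<bar>forward_jump T t - s\<bar> * B" using d(2) that B(1) by (intro mult_right_mono) auto
    finally show ?thesis using B(1) by simp
  qed
  then show "\<exists>d>0. \<forall>s\<in>T. \<bar>s - t\<bar> < d \<longrightarrow> norm (L (F (forward_jump T t)) - L (F s) - (forward_jump T t - s) *\<^sub>R L D) \<le> e * \<bar>forward_jump T t - s\<bar>"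
    using d(1) by blast
qed

lemma has_delta_derivative_diff:
  assumes F: "has_delta_derivative T F D t" and G: "has_delta_derivative T G D' t"
  shows "has_delta_derivative T (\<lambda>s. F s - G s) (D - D') t"
  unfolding has_delta_derivative_def
proof (intro allI impI)
  fix e :: real assume "e > 0"
  then have "e / 2 > 0" by simp
  obtain d where d: "d > 0" "\<forall>s\<in>T. \<bar>s - t\<bar> < d \<longrightarrow>
      norm (F (forward_jump T t) - F s - (forward_jump T t - s) *\<^sub>R D) \<le> e / 2 * \<bar>forward_jump T t - s\<bar>"
    using F \<open>e / 2 > 0\<close> unfolding has_delta_derivative_def by blast
  obtain d' where d': "d' > 0" "\<forall>s\<in>T. \<bar>s - t\<bar> < d' \<longrightarrow>
      norm (G (forward_jump T t) - G s - (forward_jump T t - s) *\<^sub>R D') \<le> e / 2 * \<bar>forward_jump T t - s\<bar>"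
    using G \<open>e / 2 > 0\<close> unfolding has_delta_derivative_def by blast
  have "norm (F (forward_jump T t) - G (forward_jump T t) - (F s - G s) - (forward_jump T t - s) *\<^sub>R (D - D')) \<le> e * \<bar>forward_jump T t - s\<bar>"
    if "s \<in> T" "\<bar>s - t\<bar> < min d d'" for s
  proof -
    have "F (forward_jump T t) - G (forward_jump T t) - (F s - G s) - (forward_jump T t - s) *\<^sub>R (D - D')
      = (F (forward_jump T t) - F s - (forward_jump T t - s) *\<^sub>R D) - (G (forward_jump T t) - G s - (forward_jump T t - s) *\<^sub>R D')"
      by (simp add: algebra_simps)
    also have "norm \<dots> \<le> e / 2 * \<bar>forward_jump T t - s\<bar> + e / 2 * \<bar>forward_jump T t - s\<bar>"
      by (rule norm_triangle_le_diff, rule add_mono) (use d(2) d'(2) that in auto)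
    finally show ?thesis by (simp add: field_simps)
  qed
  then show "\<exists>d>0. \<forall>s\<in>T. \<bar>s - t\<bar> < d \<longrightarrow> norm (F (forward_jump T t) - G (forward_jump T t) - (F s - G s) - (forward_jump T t - s) *\<^sub>R (D - D')) \<le> e * \<bar>forward_jump T t - s\<bar>"
    using d(1) d'(1) by (intro exI[of _ "min d d'"]) auto
qed

lemma bounded_bilinear_matrix_matrix_mult:
  "bounded_bilinear ((**) :: real^'n^'m \<Rightarrow> real^'k^'n \<Rightarrow> real^'k^'m)"
proof -
  have "bilinear ((**) :: real^'n^'m \<Rightarrow> real^'k^'n \<Rightarrow> real^'k^'m)"
    unfolding bilinear_def linear_iff
    by (auto simp: matrix_matrix_mult_def vec_eq_iff algebra_simps sum.distrib sum_distrib_left)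
  then show ?thesis by (simp add: bilinear_conv_bounded_bilinear)
qed

lemma bounded_bilinear_matrix_vector_mult:
  "bounded_bilinear ((*v) :: real^'n^'m \<Rightarrow> real^'n \<Rightarrow> real^'m)"
proof -
  have "bilinear ((*v) :: real^'n^'m \<Rightarrow> real^'n \<Rightarrow> real^'m)"
    unfolding bilinear_def linear_iff
    by (auto simp: matrix_vector_mult_def vec_eq_iff algebra_simps sum.distrib sum_distrib_left)
  then show ?thesis by (simp add: bilinear_conv_bounded_bilinear)
qed

interpretation matrix_matrix_mult:
  bounded_bilinear "(**) :: real^'n^'m \<Rightarrow> real^'k^'n \<Rightarrow> real^'k^'m"
  by (rule bounded_bilinear_matrix_matrix_mult)

interpretation matrix_vector_mult:
  bounded_bilinear "(*v) :: real^'n^'m \<Rightarrow> real^'n \<Rightarrow> real^'m"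
  by (rule bounded_bilinear_matrix_vector_mult)

lemma
  fixes M :: "'a::semiring_1^'n^'m"
  assumes "invertible M"
  shows matrix_inv_right: "M ** matrix_inv M = mat 1" and matrix_inv_left: "matrix_inv M ** M = mat 1"
  using someI_ex[OF assms[unfolded invertible_def]] unfolding matrix_inv_def by blast+

lemma invertible_zero_imp:
  fixes M :: "real^'n^'n"
  assumes "invertible M"
  shows "M *v x = 0 \<Longrightarrow> x = 0" and "M ** X = 0 \<Longrightarrow> X = 0"
proof -
  obtain N where N: "N ** M = mat 1" using assms unfolding invertible_def by blast
  show "M *v x = 0 \<Longrightarrow> x = 0" using N by (metis matrix_vector_mul_assoc matrix_vector_mul_lid matrix_vector_mult_0_right)
  show "M ** X = 0 \<Longrightarrow> X = 0" using N by (metis matrix_mul_assoc matrix_mul_lid matrix_matrix_mult.zero_right)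
qed

section \<open>Restriction of a time scale to a half-line\<close>

context unbounded_time_scale
begin

lemma has_delta_derivative_cong:
  assumes "has_delta_derivative T F D t" "t \<in> T" "\<And>s. s \<in> T \<Longrightarrow> F s = G s"
  shows "has_delta_derivative T G D t"
  using assms forward_jump_in[OF assms(2)] unfolding has_delta_derivative_def by simp

lemma unbounded_time_scale_Int: "unbounded_time_scale (T \<inter> {a..})"
proof
  show "closed (T \<inter> {a..})" using closed_T by auto
  show "\<exists>t\<in>T \<inter> {a..}. x < t" for x using unbounded_above[of "max x a"] by auto
qed

lemma initial_time_scale_Int: "a \<in> T \<Longrightarrow> initial_time_scale (T \<inter> {a..}) a"
  using unbounded_time_scale_Int by (auto simp: initial_time_scale_def initial_time_scale_axioms_def)

lemma forward_jump_Int: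
  assumes "a \<le> t" shows "forward_jump (T \<inter> {a..}) t = \<sigma> t"
proof -
  interpret I: unbounded_time_scale "T \<inter> {a..}" by (rule unbounded_time_scale_Int)
  have "{s \<in> T \<inter> {a..}. t < s} = {s \<in> T. t < s}" using assms by auto
  then show ?thesis unfolding forward_jump_eq I.forward_jump_eq by simp
qed

lemma has_delta_derivative_restrict:
  "has_delta_derivative T F D t \<Longrightarrow> a \<le> t \<Longrightarrow> has_delta_derivative (T \<inter> {a..}) F D t"
  unfolding has_delta_derivative_def by (simp add: forward_jump_Int) blast

text \<open>Near \<open>t > a\<close> all points of \<open>T\<close> belong to the half-line, so the
  radius need only be cut down to \<open>t - a\<close>. At \<open>t = a\<close> points of
  \<open>T\<close> to the left would be missed, which is why starting points strictly below
  \<open>t\<close> are sought later.\<close>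

lemma has_delta_derivative_extend:
  assumes der: "has_delta_derivative (T \<inter> {a..}) F D t" and "a < t"
  shows "has_delta_derivative T F D t"
  unfolding has_delta_derivative_def
proof (intro allI impI)
  fix e :: real assume "e > 0"
  then obtain d where d: "d > 0" "\<forall>s\<in>T \<inter> {a..}. \<bar>s - t\<bar> < d \<longrightarrow>
     norm (F (\<sigma> t) - F s - (\<sigma> t - s) *\<^sub>R D) \<le> e * \<bar>\<sigma> t - s\<bar>"
    using der \<open>a < t\<close> unfolding has_delta_derivative_def by (simp add: forward_jump_Int) blast
  then have "\<forall>s\<in>T. \<bar>s - t\<bar> < min d (t - a) \<longrightarrow> norm (F (\<sigma> t) - F s - (\<sigma> t - s) *\<^sub>R D) \<le> e * \<bar>\<sigma> t - s\<bar>"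
    by auto
  then show "\<exists>d>0. \<forall>s\<in>T. \<bar>s - t\<bar> < d \<longrightarrow> norm (F (\<sigma> t) - F s - (\<sigma> t - s) *\<^sub>R D) \<le> e * \<bar>\<sigma> t - s\<bar>"
    using d(1) \<open>a < t\<close> by (intro exI[of _ "min d (t - a)"]) auto
qed

lemma left_dense_Int:
  assumes "left_dense (T \<inter> {a..}) t" shows "left_dense T t"
proof -
  interpret I: unbounded_time_scale "T \<inter> {a..}" by (rule unbounded_time_scale_Int)
  have t: "t \<in> T" and ex: "\<exists>s\<in>T. s < t" using assms by (auto simp: left_dense_def)
  show ?thesis
  proof (rule ccontr)
    assume "\<not> left_dense T t"
    then obtain r where r: "r \<in> T" "r < t" "\<sigma> r = t" using ex backward_gap[OF t] by metis
    obtain s where "s \<in> T" "r < s" "s < t" using I.left_dense_approx[OF assms r(2)] by blast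
    then show False using forward_jump_le[of s r] r by auto
  qed
qed

lemma rd_continuous_Int:
  assumes "rd_continuous T f" shows "rd_continuous (T \<inter> {a..}) f"
  unfolding rd_continuous_def
proof (intro conjI allI impI)
  interpret I: unbounded_time_scale "T \<inter> {a..}" by (rule unbounded_time_scale_Int)
  fix t
  show "continuous (at t within T \<inter> {a..}) f" if "right_dense (T \<inter> {a..}) t"
  proof -
    have "right_dense T t" using that forward_jump_Int[of a t] by (auto simp: right_dense_iff I.right_dense_iff)
    then show ?thesis using assms continuous_within_subset unfolding rd_continuous_def by blast
  qed
  show "\<exists>l. (f \<longlongrightarrow> l) (at t within T \<inter> {a..} \<inter> {..<t})" if ld: "left_dense (T \<inter> {a..}) t"
  proof -
    obtain l where l: "(f \<longlongrightarrow> l) (at t within T \<inter> {..<t})"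
      using assms left_dense_Int[OF ld] unfolding rd_continuous_def by blast
    have "(f \<longlongrightarrow> l) (at t within T \<inter> {a..} \<inter> {..<t})" by (rule tendsto_within_subset[OF l]) auto
    then show ?thesis by blast
  qed
qed

end

section \<open>Two-sided solutions of regressive systems\<close>

locale regressive_system = unbounded_time_scale +
  fixes A :: "real \<Rightarrow> real^'n^'n"
  assumes regressive: "regressive T A"
begin

lemma rd_continuous_A: "rd_continuous T A"
  using regressive by (simp add: regressive_def)

lemma invertible_step: "t \<in> T \<Longrightarrow> invertible (mat 1 + (\<sigma> t - t) *\<^sub>R A t)"
  using regressive by (simp add: regressive_def graininess_def)

lemma regressive_system_Int: "regressive_system (T \<inter> {a..}) A"
proof -
  interpret I: unbounded_time_scale "T \<inter> {a..}" by (rule unbounded_time_scale_Int)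
  show ?thesis
  proof
    show "regressive (T \<inter> {a..}) A"
      using rd_continuous_Int[OF rd_continuous_A] invertible_step
      by (auto simp: regressive_def graininess_def forward_jump_Int)
  qed
qed

lemma vector_step_inj: "t \<in> T \<Longrightarrow> x + (\<sigma> t - t) *\<^sub>R (A t *v x) = 0 \<Longrightarrow> x = 0"
  by (rule invertible_zero_imp(1)[OF invertible_step])
    (auto simp: matrix_vector_mult_add_rdistrib matrix_vector_mult.scaleR_left)

lemma matrix_step_inj: "t \<in> T \<Longrightarrow> X + (\<sigma> t - t) *\<^sub>R (A t ** X) = 0 \<Longrightarrow> X = 0"
  by (rule invertible_zero_imp(2)[OF invertible_step])
    (auto simp: matrix_matrix_mult.add_left matrix_matrix_mult.scaleR_left)

lemma vector_solution_unique:
  assumes "\<And>t. t \<in> T \<Longrightarrow> has_delta_derivative T x (A t *v x t) t"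
    and "\<And>t. t \<in> T \<Longrightarrow> has_delta_derivative T y (A t *v y t) t"
    and "a \<in> T" "x a = y a" "t \<in> T"
  shows "x t = y t"
proof -
  let ?z = "\<lambda>t. x t - y t"
  have z: "has_delta_derivative T ?z (A t *v ?z t) t" if "t \<in> T" for t
    using has_delta_derivative_diff[OF assms(1,2)[OF that]] by (simp add: matrix_vector_mult.diff_right)
  have "?z t = 0"
    using linear_zero_forward[OF bounded_bilinear_matrix_vector_mult rd_continuous_imp_regulated_on[OF rd_continuous_A] z assms(3) _ assms(5)]
      linear_zero_backward[OF bounded_bilinear_matrix_vector_mult rd_continuous_imp_regulated_on[OF rd_continuous_A] vector_step_inj z assms(3) _ assms(5)]
      assms(4) by force
  then show ?thesis by simp
qed

lemma matrix_solution_unique: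
  fixes X Y :: "real \<Rightarrow> real^'n^'n"
  assumes "\<And>t. t \<in> T \<Longrightarrow> has_delta_derivative T X (A t ** X t) t"
    and "\<And>t. t \<in> T \<Longrightarrow> has_delta_derivative T Y (A t ** Y t) t"
    and "a \<in> T" "X a = Y a" "t \<in> T"
  shows "X t = Y t"
proof -
  let ?z = "\<lambda>t. X t - Y t"
  have z: "has_delta_derivative T ?z (A t ** ?z t) t" if "t \<in> T" for t
    using has_delta_derivative_diff[OF assms(1,2)[OF that]] by (simp add: matrix_matrix_mult.diff_right)
  have "?z t = 0"
    using linear_zero_forward[OF bounded_bilinear_matrix_matrix_mult rd_continuous_imp_regulated_on[OF rd_continuous_A] z assms(3) _ assms(5)]
      linear_zero_backward[OF bounded_bilinear_matrix_matrix_mult rd_continuous_imp_regulated_on[OF rd_continuous_A] matrix_step_inj z assms(3) _ assms(5)]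
      assms(4) by force
  then show ?thesis by simp
qed

lemma matrix_solution_mult:
  assumes "has_delta_derivative T X (A t ** X t) t"
  shows "has_delta_derivative T (\<lambda>s. X s ** C) (A t ** (X t ** C)) t"
  using has_delta_derivative_linear[OF matrix_matrix_mult.bounded_linear_left assms, of C]
  by (simp add: matrix_mul_assoc)

lemma matrix_solution_vector:
  assumes "has_delta_derivative T X (A t ** X t) t"
  shows "has_delta_derivative T (\<lambda>s. X s *v c) (A t *v (X t *v c)) t"
  using has_delta_derivative_linear[OF matrix_vector_mult.bounded_linear_left assms, of c]
  by (simp add: matrix_vector_mul_assoc)

text \<open>If \<open>X t\<close> kills \<open>v\<close>, then \<open>X\<close> applied to
  \<open>v\<close> is a vector solution vanishing at \<open>t\<close>, hence everywhere on
  \<open>T\<close> by two-sided uniqueness, and at \<open>a\<close> it equals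
  \<open>v\<close>.\<close>

lemma matrix_solution_invertible:
  fixes X :: "real \<Rightarrow> real^'n^'n"
  assumes X: "\<And>t. t \<in> T \<Longrightarrow> has_delta_derivative T X (A t ** X t) t"
    and a: "a \<in> T" "X a = mat 1" and t: "t \<in> T"
  shows "invertible (X t)"
proof -
  have zero: "has_delta_derivative T (\<lambda>_. 0) (A s *v 0) s" for s
    by (auto simp: has_delta_derivative_def intro!: exI[of _ 1])
  have "v = 0" if "X t *v v = 0" for v
  proof -
    have "X a *v v = 0"
      by (rule vector_solution_unique[where x = "\<lambda>t. X t *v v" and y = "\<lambda>_. 0" and a = t])
        (use that t a zero in \<open>auto intro!: matrix_solution_vector X\<close>)
    then show ?thesis using a by simp
  qed
  then show ?thesis using matrix_left_invertible_ker invertible_left_inverse by blast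
qed

text \<open>Chosen rather than described as unique, because solutions that agree on
  \<open>T \<inter> {a..}\<close> may differ elsewhere. Values below \<open>a\<close> carry no
  information.\<close>

definition forward_solution :: "real \<Rightarrow> real \<Rightarrow> real^'n^'n" where
  "forward_solution a = (SOME X. X a = mat 1 \<and>
     (\<forall>t\<in>T \<inter> {a..}. has_delta_derivative (T \<inter> {a..}) X (A t ** X t) t))"

lemma forward_solution:
  assumes "a \<in> T"
  shows "forward_solution a a = mat 1"
    and "t \<in> T \<inter> {a..} \<Longrightarrow> has_delta_derivative (T \<inter> {a..}) (forward_solution a) (A t ** forward_solution a t) t"
proof -
  interpret I: initial_time_scale "T \<inter> {a..}" a by (rule initial_time_scale_Int[OF assms])
  have "\<exists>X :: real \<Rightarrow> real^'n^'n. X a = mat 1 \<and> (\<forall>t\<in>T \<inter> {a..}. has_delta_derivative (T \<inter> {a..}) X (A t ** X t) t)"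
    using I.linear_solution_exists[OF bounded_bilinear_matrix_matrix_mult rd_continuous_Int[OF rd_continuous_A], of "mat 1"]
    by metis
  from someI_ex[OF this]
  show "forward_solution a a = mat 1"
    and "t \<in> T \<inter> {a..} \<Longrightarrow> has_delta_derivative (T \<inter> {a..}) (forward_solution a) (A t ** forward_solution a t) t"
    unfolding forward_solution_def by blast+
qed

lemma forward_solution_invertible:
  assumes "a \<in> T" "t \<in> T" "a \<le> t"
  shows "invertible (forward_solution a t)"
proof -
  interpret I: regressive_system "T \<inter> {a..}" A by (rule regressive_system_Int)
  show ?thesis using assms forward_solution
    by (intro I.matrix_solution_invertible[of "forward_solution a" a t]) auto
qed

text \<open>Both sides solve the equation on the smaller half-line \<open>T \<inter> {b..}\<close>
  and agree at \<open>b\<close>.\<close>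

lemma forward_solution_mult:
  assumes "a \<in> T" "b \<in> T" "t \<in> T" "a \<le> b" "b \<le> t"
  shows "forward_solution a t = forward_solution b t ** forward_solution a b"
proof -
  interpret I: unbounded_time_scale "T \<inter> {a..}" by (rule unbounded_time_scale_Int)
  interpret J: regressive_system "T \<inter> {b..}" A by (rule regressive_system_Int)
  have eq: "T \<inter> {a..} \<inter> {b..} = T \<inter> {b..}" using assms by auto
  show ?thesis
  proof (rule J.matrix_solution_unique[where a = b and X = "forward_solution a"
        and Y = "\<lambda>t. forward_solution b t ** forward_solution a b"])
    show "has_delta_derivative (T \<inter> {b..}) (forward_solution a) (A t ** forward_solution a t) t" if "t \<in> T \<inter> {b..}" for t
      using I.has_delta_derivative_restrict[OF forward_solution(2)[OF assms(1)], of t b] that assms by (auto simp: eq)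
    show "has_delta_derivative (T \<inter> {b..}) (\<lambda>t. forward_solution b t ** forward_solution a b)
        (A t ** (forward_solution b t ** forward_solution a b)) t" if "t \<in> T \<inter> {b..}" for t
      using J.matrix_solution_mult[OF forward_solution(2)[OF assms(2) that]] .
  qed (use assms forward_solution(1) in auto)
qed

lemma matrix_inv_mult:
  fixes M N :: "real^'n^'n"
  assumes "invertible N" shows "M ** N ** matrix_inv N = M"
  using assms by (simp add: matrix_inv_right flip: matrix_mul_assoc)

text \<open>To the left of \<open>t0\<close> the value has to be the inverse of the forward solution
  from \<open>t\<close> to \<open>t0\<close>. Its derivative is found by rewriting: for any
  \<open>a\<close> in \<open>T\<close> below both \<open>t\<close> and \<open>t0\<close>, the
  formula is the forward solution from \<open>a\<close> times a constant matrix.\<close>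

lemma matrix_solution_exists:
  assumes t0: "t0 \<in> T"
  obtains X :: "real \<Rightarrow> real^'n^'n" where "X t0 = mat 1" "\<And>t. t \<in> T \<Longrightarrow> has_delta_derivative T X (A t ** X t) t"
proof -
  let ?E = forward_solution
  define X where "X t = (if t0 \<le> t then ?E t0 t else matrix_inv (?E t t0))" for t
  have X_t0: "X t0 = mat 1" by (simp add: X_def forward_solution(1) t0)
  have X: "X t = ?E a t ** matrix_inv (?E a t0)" if "a \<in> T" "t \<in> T" "a \<le> t" "a \<le> t0" for a t
  proof (cases "t0 \<le> t")
    case True
    have "?E a t = ?E t0 t ** ?E a t0" using that t0 True by (intro forward_solution_mult)
    then show ?thesis using matrix_inv_mult[OF forward_solution_invertible[of a t0]] that t0 True by (simp add: X_def)
  next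
    case False
    have inv: "invertible (?E t t0)" "invertible (?E a t0)" using that t0 False by (auto intro: forward_solution_invertible)
    have "?E a t0 = ?E t t0 ** ?E a t" using that t0 False by (intro forward_solution_mult) auto
    then have "?E t t0 ** (?E a t ** matrix_inv (?E a t0)) = mat 1"
      using matrix_inv_right[OF inv(2)] by (simp add: matrix_mul_assoc)
    then have "matrix_inv (?E t t0) ** (?E t t0 ** (?E a t ** matrix_inv (?E a t0))) = matrix_inv (?E t t0)" by simp
    then have "?E a t ** matrix_inv (?E a t0) = matrix_inv (?E t t0)"
      using matrix_inv_left[OF inv(1)] by (metis matrix_mul_assoc matrix_mul_lid)
    then show ?thesis using False by (simp add: X_def)
  qed
  have "has_delta_derivative T X (A t ** X t) t" if t: "t \<in> T" for t
  proof -
    \<comment> \<open>The point \<open>a\<close> is taken strictly below \<open>t\<close> when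
      possible, so that the derivative on the half-line extends to \<open>T\<close>. If no point of
      \<open>T\<close> lies below \<open>min t t0\<close>, that minimum is the least point of
      \<open>T\<close> and the restriction changes nothing.\<close>
    obtain a where a: "a \<in> T" "a \<le> t" "a \<le> t0" and a': "a < t \<or> T \<inter> {a..} = T"
    proof (cases "\<exists>a\<in>T. a < min t t0")
      case True
      then obtain a where "a \<in> T" "a < t" "a < t0" by auto
      then show thesis by (intro that[of a]) auto
    next
      case False
      then have "T \<inter> {min t t0..} = T" by force
      then show thesis using t t0 by (intro that[of "min t t0"]) (auto simp: min_def)
    qed
    interpret I: regressive_system "T \<inter> {a..}" A by (rule regressive_system_Int)
    have "has_delta_derivative (T \<inter> {a..}) (\<lambda>s. ?E a s ** matrix_inv (?E a t0)) (A t ** (?E a t ** matrix_inv (?E a t0))) t"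
      using forward_solution(2)[OF a(1)] a t by (intro I.matrix_solution_mult) auto
    then have "has_delta_derivative (T \<inter> {a..}) X (A t ** X t) t"
      unfolding X[OF a(1) t a(2,3)] by (rule I.has_delta_derivative_cong) (use a t in \<open>auto simp: X\<close>)
    then show ?thesis using a' has_delta_derivative_extend by auto
  qed
  with X_t0 show thesis by (rule that)
qed

abbreviation \<Phi> :: "real \<Rightarrow> real \<Rightarrow> real^'n^'n" where "\<Phi> \<equiv> transition_matrix T A"

lemma transition_matrix_eq:
  assumes X: "\<And>t. t \<in> T \<Longrightarrow> has_delta_derivative T X (A t ** X t) t" and "\<tau> \<in> T" "X \<tau> = mat 1" "t \<in> T"
  shows "\<Phi> t \<tau> = X t"
  unfolding transition_matrix_def
proof (rule the_equality)
  show "\<exists>X'. (\<forall>s\<in>T. has_delta_derivative T X' (A s ** X' s) s) \<and> X' \<tau> = mat 1 \<and> X t = X' t"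
    using assms by blast
  show "M = X t" if ex: "\<exists>X'. (\<forall>s\<in>T. has_delta_derivative T X' (A s ** X' s) s) \<and> X' \<tau> = mat 1 \<and> M = X' t" for M
  proof -
    obtain X' where X': "\<forall>s\<in>T. has_delta_derivative T X' (A s ** X' s) s" "X' \<tau> = mat 1" "M = X' t"
      using ex by blast
    then show ?thesis using matrix_solution_unique[of X' X \<tau> t] assms by auto
  qed
qed

lemma transition_matrix_self:
  assumes "\<tau> \<in> T" shows "\<Phi> \<tau> \<tau> = mat 1"
proof -
  obtain X :: "real \<Rightarrow> real^'n^'n" where X: "X \<tau> = mat 1" "\<And>t. t \<in> T \<Longrightarrow> has_delta_derivative T X (A t ** X t) t"
    using matrix_solution_exists[OF assms] by blast
  show ?thesis using transition_matrix_eq[OF X(2) assms X(1) assms] X(1) by simp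
qed

lemma transition_matrix_derivative:
  assumes "\<tau> \<in> T" "t \<in> T"
  shows "has_delta_derivative T (\<lambda>t. \<Phi> t \<tau>) (A t ** \<Phi> t \<tau>) t"
proof -
  obtain X :: "real \<Rightarrow> real^'n^'n" where X: "X \<tau> = mat 1" "\<And>t. t \<in> T \<Longrightarrow> has_delta_derivative T X (A t ** X t) t"
    using matrix_solution_exists[OF assms(1)] by blast
  have eq: "\<Phi> s \<tau> = X s" if "s \<in> T" for s using transition_matrix_eq[OF X(2) assms(1) X(1) that] .
  show ?thesis unfolding eq[OF assms(2)]
    by (rule has_delta_derivative_cong[OF X(2)[OF assms(2)] assms(2)]) (simp add: eq)
qed

lemma transition_matrix_mult:
  assumes "r \<in> T" "s \<in> T" "t \<in> T"
  shows "\<Phi> t s ** \<Phi> s r = \<Phi> t r"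
proof (rule matrix_solution_unique[where a = s and X = "\<lambda>t. \<Phi> t s ** \<Phi> s r" and Y = "\<lambda>t. \<Phi> t r"])
  fix t assume t: "t \<in> T"
  show "has_delta_derivative T (\<lambda>t. \<Phi> t s ** \<Phi> s r) (A t ** (\<Phi> t s ** \<Phi> s r)) t"
    by (rule matrix_solution_mult[OF transition_matrix_derivative[OF assms(2) t]])
  show "has_delta_derivative T (\<lambda>t. \<Phi> t r) (A t ** \<Phi> t r) t"
    by (rule transition_matrix_derivative[OF assms(1) t])
qed (simp_all add: assms transition_matrix_self)

lemma transition_matrix_inverse:
  "s \<in> T \<Longrightarrow> t \<in> T \<Longrightarrow> \<Phi> t s ** \<Phi> s t = mat 1"
  using transition_matrix_mult[of t s t] transition_matrix_self[of t] by simp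

lemma transition_matrix_continuous: "\<tau> \<in> T \<Longrightarrow> continuous_on T (\<lambda>t. \<Phi> t \<tau>)"
  by (rule has_delta_derivative_continuous_on) (rule transition_matrix_derivative)

end


section \<open>Variation of constants and periodicity\<close>

text \<open>The identity \<open>C s - C0 = C s ** ((B0 - B s) ** C0)\<close> bounds the error by
  \<open>norm (C s) * q s\<close> with \<open>q\<close> tending to 0. Once
  \<open>q s < 1 / 2\<close>, the same estimate bounds \<open>norm (C s)\<close> by
  \<open>2 * norm C0\<close>.\<close>

lemma matrix_inverse_tendsto:
  fixes B C :: "'b \<Rightarrow> real^'n^'n"
  assumes B: "(B \<longlongrightarrow> B0) F" and inv: "\<And>s. eventually (\<lambda>s. C s ** B s = mat 1) F" "B0 ** C0 = mat 1"
  shows "(C \<longlongrightarrow> C0) F"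
proof -
  obtain K where K: "K > 0" "\<And>(X :: real^'n^'n) (Y :: real^'n^'n). norm (X ** Y) \<le> norm X * norm Y * K"
    using matrix_matrix_mult.pos_bounded by blast
  define q where "q s = norm ((B0 - B s) ** C0) * K" for s
  have "(q \<longlongrightarrow> norm ((B0 - B0) ** C0) * K) F"
    unfolding q_def by (intro tendsto_mult tendsto_norm matrix_matrix_mult.tendsto tendsto_diff B tendsto_const)
  then have q: "(q \<longlongrightarrow> 0) F" by simp
  then have "eventually (\<lambda>s. q s < 1 / 2) F" by (rule order_tendstoD) simp
  with inv(1) have "eventually (\<lambda>s. norm (C s - C0) \<le> 2 * norm C0 * q s) F"
  proof eventually_elim
    case (elim s)
    have "C s - C0 = C s ** ((B0 - B s) ** C0)"
      using elim(1) inv(2) by (simp add: matrix_matrix_mult.diff_left matrix_matrix_mult.diff_right matrix_mul_assoc)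
    then have 1: "norm (C s - C0) \<le> norm (C s) * q s"
      using K(2)[of "C s" "(B0 - B s) ** C0"] by (simp add: q_def mult.assoc)
    have "q s \<ge> 0" using K(1) by (simp add: q_def)
    have "norm (C s) \<le> norm C0 + norm (C s) * q s" using 1 norm_triangle_sub[of "C s" C0] by linarith
    also have "norm (C s) * q s \<le> norm (C s) * (1 / 2)" using elim(2) by (intro mult_left_mono) auto
    finally have "norm (C s) \<le> 2 * norm C0" by simp
    then have "norm (C s) * q s \<le> 2 * norm C0 * q s" using \<open>q s \<ge> 0\<close> by (rule mult_right_mono)
    with 1 show ?case by linarith
  qed
  moreover have "((\<lambda>s. 2 * norm C0 * q s) \<longlongrightarrow> 0) F" using q by (rule tendsto_mult_right_zero)
  ultimately have "((\<lambda>s. C s - C0) \<longlongrightarrow> 0) F" by (rule Lim_null_comparison)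
  then show ?thesis by (simp add: LIM_zero_iff)
qed

section \<open>Delta integrals and piecewise rd-continuous functions\<close>

context unbounded_time_scale
begin

text \<open>The difference has delta derivative 0 outside a countable set without right-scattered
  points, so the mean value inequality holds with constant 0. This gives the definite description in
  \<open>delta_integral\<close> its meaning.\<close>

lemma delta_pre_antiderivative_diff_unique:
  assumes F: "delta_pre_antiderivative T f F" and G: "delta_pre_antiderivative T f G" and ab: "a \<in> T" "b \<in> T"
  shows "F b - F a = G b - G a"
proof -
  obtain D where D: "D \<subseteq> T" "countable (T - D)" "\<forall>t\<in>T - D. \<sigma> t = t" "\<forall>t\<in>D. has_delta_derivative T F (f t) t"
    and F_cont: "continuous_on T F" using F unfolding delta_pre_antiderivative_def by blast
  obtain E where E: "E \<subseteq> T" "countable (T - E)" "\<forall>t\<in>T - E. \<sigma> t = t" "\<forall>t\<in>E. has_delta_derivative T G (f t) t"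
    and G_cont: "continuous_on T G" using G unfolding delta_pre_antiderivative_def by blast
  let ?d = "\<lambda>t. F t - G t"
  have "norm (?d v - ?d u) \<le> 0 * (v - u)" if "u \<in> T" "v \<in> T" "u \<le> v" for u v
  proof (rule delta_mean_value[where N = "(T - D) \<union> (T - E)"])
    show "\<exists>D'. has_delta_derivative T ?d D' t \<and> norm D' \<le> 0" if "t \<in> T" "t \<notin> (T - D) \<union> (T - E)" for t
      using has_delta_derivative_diff[of T F "f t" t G "f t"] D(4) E(4) that by (intro exI[of _ 0]) auto
  qed (use that D E F_cont G_cont in \<open>auto intro!: continuous_on_diff\<close>)
  from this[of a b] this[of b a] ab have "?d b = ?d a" by (cases "a \<le> b") auto
  then show ?thesis by (simp add: algebra_simps)
qed

lemma delta_integral_eq: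
  assumes "delta_pre_antiderivative T f F" "a \<in> T" "b \<in> T"
  shows "delta_integral T a b f = F b - F a"
  unfolding delta_integral_def
proof (rule the_equality)
  show "\<exists>G. delta_pre_antiderivative T f G \<and> F b - F a = G b - G a" using assms(1) by blast
  show "I = F b - F a" if "\<exists>G. delta_pre_antiderivative T f G \<and> I = G b - G a" for I
    using that delta_pre_antiderivative_diff_unique[OF assms(1) _ assms(2,3)] by auto
qed

text \<open>Serves to move a constant matrix through a delta integral.\<close>

lemma delta_pre_antiderivative_linear:
  assumes L: "bounded_linear L" and F: "delta_pre_antiderivative T f F"
    and g: "\<And>t. t \<in> T \<Longrightarrow> g t = L (f t)"
  shows "delta_pre_antiderivative T g (\<lambda>t. L (F t))"
proof -
  obtain D where D: "D \<subseteq> T" "countable (T - D)" "\<forall>t\<in>T - D. \<sigma> t = t" "\<forall>t\<in>D. has_delta_derivative T F (f t) t"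
    and F_cont: "continuous_on T F" using F unfolding delta_pre_antiderivative_def by blast
  have "\<forall>t\<in>D. has_delta_derivative T (\<lambda>t. L (F t)) (g t) t"
    using D(1,4) has_delta_derivative_linear[OF L] g by (metis subsetD)
  moreover have "continuous_on T (\<lambda>t. L (F t))"
    using F_cont by (rule bounded_linear.continuous_on[OF L])
  ultimately show ?thesis using D(1-3) unfolding delta_pre_antiderivative_def by blast
qed

lemma delta_pre_antiderivative_exists:
  fixes h :: "real \<Rightarrow> 'a::banach"
  assumes h: "regulated_on T h"
    and cnt: "countable {t \<in> T. \<sigma> t = t \<and> \<not> continuous (at t within T) h}"
  obtains H where "delta_pre_antiderivative T h H"
proof -
  obtain a where a: "a \<in> T" using unbounded_above by blast
  let ?h = "\<lambda>x. h (tfloor x)"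
  \<comment> \<open>As \<open>T\<close> may have no least point, the integral is taken with sign
    from an arbitrary base point \<open>a\<close>; only increments matter.\<close>
  define H where "H t = (if a \<le> t then integral {a..t} ?h else - integral {t..a} ?h)" for t
  have H: "H v - H u = integral {u..v} ?h" if uv: "u \<in> T" "v \<in> T" "u \<le> v" for u v
  proof -
    consider "a \<le> u" | "u < a" "a \<le> v" | "v < a" by linarith
    then show ?thesis
    proof cases
      case 1
      then show ?thesis using integral_tfloor_split[OF h a, of u v] uv by (simp add: H_def)
    next
      case 2
      then show ?thesis using integral_tfloor_split[OF h uv(1), of a v] uv by (simp add: H_def algebra_simps)
    next
      case 3
      then show ?thesis using integral_tfloor_split[OF h uv(1), of v a] uv by (simp add: H_def algebra_simps)
    qed
  qed
  let ?N = "{t \<in> T. \<sigma> t = t \<and> \<not> continuous (at t within T) h}"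
  have "T - (T - ?N) = ?N" by auto
  moreover have "\<forall>t\<in>T - ?N. has_delta_derivative T H (h t) t"
    using delta_derivative_of_integral(2,3)[OF h H] by blast
  ultimately have "delta_pre_antiderivative T h H"
    unfolding delta_pre_antiderivative_def using cnt delta_derivative_of_integral(1)[OF h H]
    by (intro conjI exI[of _ "T - ?N"]) auto
  then show thesis by (rule that)
qed

text \<open>On the right, the half-open piece containing \<open>t\<close> also contains the nearby
  later points. On the left, \<open>t\<close> may be the left end of its piece, so a piece with
  \<open>c < t \<le> d\<close> is needed; finiteness of the decomposition provides it.\<close>

lemma C_prd_regulated_on:
  assumes f: "f \<in> C_prd T"
  shows "regulated_on T f"
  unfolding regulated_on_def
proof (intro allI conjI)
  fix t
  have in_T: "t \<in> T" if "t islimpt (T \<inter> X)" for X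
    using that closed_T closed_limpt islimpt_subset[of t "T \<inter> X" T] by blast
  obtain S where S: "finite S" "{t - 1..<t + 1} \<inter> T = (\<Union>(c, d)\<in>S. {c..<d} \<inter> T)"
    "\<forall>(c, d)\<in>S. \<exists>g. rd_continuous T g \<and> (\<forall>t\<in>{c..<d} \<inter> T. f t = g t)"
    using f unfolding C_prd_def by blast
  show "\<exists>l. (f \<longlongrightarrow> l) (at t within (T \<inter> {t<..}))"
  proof (cases "t islimpt (T \<inter> {t<..})")
    case True
    then have "t \<in> {t - 1..<t + 1} \<inter> T" using in_T by auto
    then obtain c d where cd: "(c, d) \<in> S" "c \<le> t" "t < d" unfolding S(2) by auto
    then obtain g where g: "rd_continuous T g" "\<forall>t\<in>{c..<d} \<inter> T. f t = g t" using S(3) by blast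
    obtain l where l: "(g \<longlongrightarrow> l) (at t within (T \<inter> {t<..}))"
      using rd_continuous_imp_regulated_on[OF g(1)] unfolding regulated_on_def by blast
    have "eventually (\<lambda>s. f s = g s) (at t within (T \<inter> {t<..}))"
      unfolding eventually_at using cd g(2) by (intro exI[of _ "d - t"]) (auto simp: dist_real_def)
    then have "(f \<longlongrightarrow> l) (at t within (T \<inter> {t<..}))" using l by (simp add: tendsto_cong)
    then show ?thesis by (rule exI)
  qed (metis tendsto_bot trivial_limit_within)
  show "\<exists>l. (f \<longlongrightarrow> l) (at t within (T \<inter> {..<t}))"
  proof (cases "t islimpt (T \<inter> {..<t})")
    case True
    have "\<exists>(c, d)\<in>S. c < t \<and> t \<le> d"
    proof (rule ccontr)
      assume no: "\<not> ?thesis"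
      \<comment> \<open>The largest right end below \<open>t\<close>, or \<open>t - 1\<close>. The
        piece containing a point of \<open>T\<close> between \<open>y\<close> and \<open>t\<close>
        ends after \<open>y\<close>, hence not before \<open>t\<close>.\<close>
      define y where "y = Max (insert (t - 1) {d \<in> snd ` S. d < t})"
      have fin: "finite (insert (t - 1) {d \<in> snd ` S. d < t})" using S(1) by simp
      have "y < t" unfolding y_def using fin by (subst Max_less_iff) auto
      then obtain s where s: "s \<in> T" "s < t" "dist s t < t - y"
        using True unfolding islimpt_approachable by (metis Int_iff diff_gt_0_iff_gt lessThan_iff)
      then have "y < s" by (simp add: dist_real_def)
      moreover have "t - 1 \<le> y" unfolding y_def using fin by (intro Max_ge) auto
      ultimately have "s \<in> {t - 1..<t + 1} \<inter> T" using s by auto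
      then obtain c d where cd: "(c, d) \<in> S" "c \<le> s" "s < d" unfolding S(2) by auto
      then have "d < t" using no s by force
      then have "d \<le> y" unfolding y_def using fin cd(1) by (intro Max_ge) force+
      then show False using cd \<open>y < s\<close> by simp
    qed
    then obtain c d where cd: "(c, d) \<in> S" "c < t" "t \<le> d" by blast
    then obtain g where g: "rd_continuous T g" "\<forall>t\<in>{c..<d} \<inter> T. f t = g t" using S(3) by blast
    obtain l where l: "(g \<longlongrightarrow> l) (at t within (T \<inter> {..<t}))"
      using rd_continuous_imp_regulated_on[OF g(1)] unfolding regulated_on_def by blast
    have "eventually (\<lambda>s. f s = g s) (at t within (T \<inter> {..<t}))"
      unfolding eventually_at using cd g(2) by (intro exI[of _ "t - c"]) (auto simp: dist_real_def)
    then have "(f \<longlongrightarrow> l) (at t within (T \<inter> {..<t}))" using l by (simp add: tendsto_cong)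
    then show ?thesis by (rule exI)
  qed (metis tendsto_bot trivial_limit_within)
qed

text \<open>A right-dense discontinuity must be the left end of its piece, as in the interior of a
  piece \<open>f\<close> agrees locally with an rd-continuous function. Each \<open>[- n, n)\<close>
  contributes finitely many left ends.\<close>

lemma C_prd_countable_discontinuities:
  assumes f: "f \<in> C_prd T"
  shows "countable {t \<in> T. \<sigma> t = t \<and> \<not> continuous (at t within T) f}"
proof -
  have "\<forall>n::nat. \<exists>S. finite S \<and> {- real n..<real n} \<inter> T = (\<Union>(c, d)\<in>S. {c..<d} \<inter> T) \<and>
    (\<forall>(c, d)\<in>S. \<exists>g. rd_continuous T g \<and> (\<forall>t\<in>{c..<d} \<inter> T. f t = g t))"
    using f unfolding C_prd_def by blast
  from choice[OF this] obtain S where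
    "\<forall>n::nat. finite (S n) \<and> {- real n..<real n} \<inter> T = (\<Union>(c, d)\<in>S n. {c..<d} \<inter> T) \<and>
      (\<forall>(c, d)\<in>S n. \<exists>g. rd_continuous T g \<and> (\<forall>t\<in>{c..<d} \<inter> T. f t = g t))" ..
  then have S: "finite (S n)" "{- real n..<real n} \<inter> T = (\<Union>(c, d)\<in>S n. {c..<d} \<inter> T)"
    "\<forall>(c, d)\<in>S n. \<exists>g. rd_continuous T g \<and> (\<forall>t\<in>{c..<d} \<inter> T. f t = g t)" for n
    by simp_all
  have "t \<in> (\<Union>n. fst ` S n)" if t: "t \<in> T" "\<sigma> t = t" "\<not> continuous (at t within T) f" for t
  proof -
    obtain n where "\<bar>t\<bar> < real n" using reals_Archimedean2 by blast
    then have "t \<in> {- real n..<real n} \<inter> T" using t by auto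
    then obtain c d where cd: "(c, d) \<in> S n" "c \<le> t" "t < d" unfolding S(2) by auto
    then obtain g where g: "rd_continuous T g" "\<forall>t\<in>{c..<d} \<inter> T. f t = g t" using S(3) by blast
    have "c = t"
    proof (rule ccontr)
      assume "c \<noteq> t"
      with cd have "c < t" by simp
      have "f s = g s" if "s \<in> T" "dist s t < min (d - t) (t - c)" for s
        using g(2)[rule_format, of s] that by (auto simp: dist_real_def abs_less_iff)
      then have "eventually (\<lambda>s. f s = g s) (at t within T)"
        unfolding eventually_at using cd \<open>c < t\<close> by (intro exI[of _ "min (d - t) (t - c)"]) auto
      moreover have "(g \<longlongrightarrow> g t) (at t within T)"
        using g(1) t right_dense_iff unfolding rd_continuous_def continuous_within by blast
      moreover have "f t = g t" using g(2) t cd by auto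
      ultimately have "continuous (at t within T) f" unfolding continuous_within by (simp add: tendsto_cong)
      then show False using t by blast
    qed
    then show ?thesis using cd(1) by force
  qed
  then have "{t \<in> T. \<sigma> t = t \<and> \<not> continuous (at t within T) f} \<subseteq> (\<Union>n. fst ` S n)" by blast
  moreover have "countable (\<Union>n. fst ` S n)" using S(1) by (auto intro: countable_finite)
  ultimately show ?thesis by (rule countable_subset)
qed

text \<open>At a right-dense \<open>t\<close> the jump operator is continuous, and from the left of
  a left-dense \<open>t\<close> it tends to \<open>t\<close>. If such a \<open>t\<close> is
  right-scattered, the left limit \<open>\<psi> t\<close> differs in general from the value
  \<open>\<psi> (\<sigma> t)\<close>, so no more than rd-continuity can be claimed.\<close>

lemma rd_continuous_forward_jump:
  assumes \<psi>: "continuous_on T \<psi>"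
  shows "rd_continuous T (\<lambda>t. \<psi> (\<sigma> t))"
proof -
  have lim: "((\<lambda>s. \<psi> (\<sigma> s)) \<longlongrightarrow> \<psi> t) (at t within (T \<inter> X))"
    if t: "t \<in> T" and \<sigma>: "(\<sigma> \<longlongrightarrow> t) (at t within (T \<inter> X))" for t X
  proof (rule continuous_on_tendsto_compose[OF \<psi> \<sigma> t])
    show "eventually (\<lambda>s. \<sigma> s \<in> T) (at t within (T \<inter> X))"
      by (auto simp: eventually_at_filter forward_jump_in)
  qed
  show ?thesis
    unfolding rd_continuous_def
  proof (intro conjI allI impI)
    fix t assume "right_dense T t"
    then have t: "t \<in> T" "\<sigma> t = t" by (auto simp: right_dense_iff)
    have "(\<sigma> \<longlongrightarrow> t) (at t within (T \<inter> UNIV))"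
      unfolding Lim_within
    proof (intro allI impI)
      fix e :: real assume "e > 0"
      \<comment> \<open>A point \<open>q\<close> of \<open>T\<close> just to the right of
        \<open>t\<close> caps \<open>\<sigma> s\<close> for all \<open>s < q\<close>.\<close>
      then obtain q where q: "q \<in> T" "t < q" "q < t + e" using forward_jump_less_imp[of t "t + e"] t by auto
      have "dist (\<sigma> s) t < e" if s: "s \<in> T" "dist s t < min e (q - t)" for s
      proof (cases "s < t")
        case True
        then have "s \<le> \<sigma> s" "\<sigma> s \<le> t" using forward_jump_ge forward_jump_le t(1) by auto
        then show ?thesis using s by (simp add: dist_real_def)
      next
        case False
        then have "s \<le> \<sigma> s" "\<sigma> s \<le> q" using forward_jump_ge forward_jump_le[OF q(1), of s] s by (auto simp: dist_real_def)
        then show ?thesis using q False by (simp add: dist_real_def)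
      qed
      then show "\<exists>d>0. \<forall>s\<in>T \<inter> UNIV. 0 < dist s t \<and> dist s t < d \<longrightarrow> dist (\<sigma> s) t < e"
        using \<open>e > 0\<close> q by (intro exI[of _ "min e (q - t)"]) auto
    qed
    from lim[OF t(1) this] show "continuous (at t within T) (\<lambda>t. \<psi> (\<sigma> t))"
      by (simp add: continuous_within t(2))
  next
    fix t assume "left_dense T t"
    then have t: "t \<in> T" by (simp add: left_dense_def)
    have "(\<sigma> \<longlongrightarrow> t) (at t within (T \<inter> {..<t}))"
    proof (rule tendsto_sandwich[of "\<lambda>s. s" _ _ "\<lambda>_. t"])
      show "eventually (\<lambda>s. s \<le> \<sigma> s) (at t within (T \<inter> {..<t}))" by (simp add: forward_jump_ge)
      show "eventually (\<lambda>s. \<sigma> s \<le> t) (at t within (T \<inter> {..<t}))"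
        using t by (auto simp: eventually_at_filter intro!: always_eventually forward_jump_le)
    qed auto
    from lim[OF t this] show "\<exists>l. ((\<lambda>t. \<psi> (\<sigma> t)) \<longlongrightarrow> l) (at t within (T \<inter> {..<t}))" by blast
  qed
qed

end

context regressive_system
begin

text \<open>In its second argument the transition matrix is the inverse of a continuous matrix
  function.\<close>

lemma transition_matrix_continuous_right:
  assumes "\<tau> \<in> T" shows "continuous_on T (\<lambda>s. \<Phi> \<tau> s)"
  unfolding continuous_on_def
proof
  fix t assume t: "t \<in> T"
  have B: "((\<lambda>s. \<Phi> s \<tau>) \<longlongrightarrow> \<Phi> t \<tau>) (at t within T)"
    using transition_matrix_continuous[OF assms] t by (simp add: continuous_on_def)
  show "((\<lambda>s. \<Phi> \<tau> s) \<longlongrightarrow> \<Phi> \<tau> t) (at t within T)"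
    by (rule matrix_inverse_tendsto[OF B])
      (use assms t in \<open>auto simp: eventually_at_filter transition_matrix_inverse\<close>)
qed

text \<open>The first argument is fixed at \<open>t0\<close> so that one antiderivative serves every
  \<open>t\<close>. The matrix factor is continuous at right-dense points, so exceptional points
  come from \<open>f\<close> alone.\<close>

lemma variation_antiderivative_exists:
  assumes t0: "t0 \<in> T" and f: "f \<in> C_prd T"
  obtains H where "delta_pre_antiderivative T (\<lambda>\<tau>. \<Phi> t0 (\<sigma> \<tau>) *v f \<tau>) H"
proof (rule delta_pre_antiderivative_exists)
  let ?h = "\<lambda>\<tau>. \<Phi> t0 (\<sigma> \<tau>) *v f \<tau>"
  have rd: "rd_continuous T (\<lambda>\<tau>. \<Phi> t0 (\<sigma> \<tau>))"
    by (rule rd_continuous_forward_jump[OF transition_matrix_continuous_right[OF t0]])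
  show "regulated_on T ?h"
    by (rule regulated_on_bounded_bilinear[OF bounded_bilinear_matrix_vector_mult
      rd_continuous_imp_regulated_on[OF rd] C_prd_regulated_on[OF f]])
  have "continuous (at t within T) ?h" if "t \<in> T" "\<sigma> t = t" "continuous (at t within T) f" for t
  proof (rule matrix_vector_mult.continuous[OF _ that(3)])
    show "continuous (at t within T) (\<lambda>\<tau>. \<Phi> t0 (\<sigma> \<tau>))"
      using rd that right_dense_iff unfolding rd_continuous_def by blast
  qed
  then have "{t \<in> T. \<sigma> t = t \<and> \<not> continuous (at t within T) ?h} \<subseteq> {t \<in> T. \<sigma> t = t \<and> \<not> continuous (at t within T) f}"
    by blast
  then show "countable {t \<in> T. \<sigma> t = t \<and> \<not> continuous (at t within T) ?h}"
    using C_prd_countable_discontinuities[OF f] by (rule countable_subset)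
qed (rule that)

text \<open>Splitting \<open>\<Phi> t (\<sigma> \<tau>)\<close> as
  \<open>\<Phi> t t0 ** \<Phi> t0 (\<sigma> \<tau>)\<close> frees the integrand from
  \<open>t\<close>.\<close>

lemma nonhomogeneous_solution_eq:
  assumes t0: "t0 \<in> T" and t: "t \<in> T"
    and H: "delta_pre_antiderivative T (\<lambda>\<tau>. \<Phi> t0 (\<sigma> \<tau>) *v f \<tau>) H"
  shows "nonhomogeneous_solution T A f t0 x0 t = \<Phi> t t0 *v (x0 + (H t - H t0))"
proof -
  have "delta_pre_antiderivative T (\<lambda>\<tau>. \<Phi> t (\<sigma> \<tau>) *v f \<tau>) (\<lambda>s. \<Phi> t t0 *v H s)"
    by (rule delta_pre_antiderivative_linear[OF matrix_vector_mult.bounded_linear_right H])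
      (simp add: matrix_vector_mul_assoc transition_matrix_mult forward_jump_in t0 t)
  from delta_integral_eq[OF this t0 t] show ?thesis
    by (simp add: nonhomogeneous_solution_def matrix_vector_mult.add_right matrix_vector_mult.diff_right)
qed

end

section \<open>Periodic systems and the monodromy matrix\<close>

locale periodic_regressive_system = regressive_system T A
  for T and A :: "real \<Rightarrow> real^'n^'n" +
  fixes p :: real
  assumes p_pos: "p > 0" and shift_in: "t \<in> T \<Longrightarrow> t + p \<in> T"
    and shift_jump: "t \<in> T \<Longrightarrow> \<sigma> (t + p) = \<sigma> t + p"
    and shift_A: "t \<in> T \<Longrightarrow> A (t + p) = A t"
begin

lemma has_delta_derivative_shift:
  assumes "has_delta_derivative T F D (t + p)" "t \<in> T"
  shows "has_delta_derivative T (\<lambda>s. F (s + p)) D t"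
  unfolding has_delta_derivative_def
proof (intro allI impI)
  fix e :: real assume "e > 0"
  then obtain d where d: "d > 0" "\<forall>s\<in>T. \<bar>s - (t + p)\<bar> < d \<longrightarrow>
     norm (F (\<sigma> t + p) - F s - (\<sigma> t + p - s) *\<^sub>R D) \<le> e * \<bar>\<sigma> t + p - s\<bar>"
    using assms unfolding has_delta_derivative_def by (metis shift_jump)
  have "norm (F (\<sigma> t + p) - F (s + p) - (\<sigma> t - s) *\<^sub>R D) \<le> e * \<bar>\<sigma> t - s\<bar>" if "s \<in> T" "\<bar>s - t\<bar> < d" for s
    using d(2)[rule_format, OF shift_in[OF that(1)]] that by simp
  then show "\<exists>d>0. \<forall>s\<in>T. \<bar>s - t\<bar> < d \<longrightarrow> norm (F (\<sigma> t + p) - F (s + p) - (\<sigma> t - s) *\<^sub>R D) \<le> e * \<bar>\<sigma> t - s\<bar>"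
    using d(1) by blast
qed

lemma transition_matrix_shift:
  assumes "s \<in> T" "t \<in> T"
  shows "\<Phi> (t + p) (s + p) = \<Phi> t s"
proof (rule matrix_solution_unique[where a = s and X = "\<lambda>t. \<Phi> (t + p) (s + p)" and Y = "\<lambda>t. \<Phi> t s"])
  fix t assume t: "t \<in> T"
  have "has_delta_derivative T (\<lambda>t. \<Phi> t (s + p)) (A t ** \<Phi> (t + p) (s + p)) (t + p)"
    using transition_matrix_derivative[OF shift_in[OF assms(1)] shift_in[OF t]] shift_A[OF t] by simp
  then show "has_delta_derivative T (\<lambda>t. \<Phi> (t + p) (s + p)) (A t ** \<Phi> (t + p) (s + p)) t"
    using t by (rule has_delta_derivative_shift)
  show "has_delta_derivative T (\<lambda>t. \<Phi> t s) (A t ** \<Phi> t s) t"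
    by (rule transition_matrix_derivative[OF assms(1) t])
qed (use assms in \<open>auto simp: transition_matrix_self shift_in\<close>)

lemma transition_matrix_shift_left:
  assumes "s \<in> T" "t \<in> T"
  shows "\<Phi> (t + p) s = \<Phi> t s ** \<Phi> (s + p) s"
  using transition_matrix_mult[of s "s + p" "t + p"] transition_matrix_shift[OF assms] assms shift_in by simp

text \<open>Multiplied by the monodromy matrix, the shifted antiderivative belongs to the original
  integrand again, because \<open>\<Phi> (t0 + p) t0 ** \<Phi> t0 (\<sigma> s + p) = \<Phi> t0
  (\<sigma> s)\<close>. Uniqueness then compares increments.\<close>

lemma antiderivative_shift:
  assumes t0: "t0 \<in> T" and t: "t \<in> T" and f: "periodic_on T p f"
    and H: "delta_pre_antiderivative T (\<lambda>\<tau>. \<Phi> t0 (\<sigma> \<tau>) *v f \<tau>) H"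
  shows "\<Phi> (t0 + p) t0 *v (H (t + p) - H (t0 + p)) = H t - H t0"
proof -
  let ?h = "\<lambda>\<tau>. \<Phi> t0 (\<sigma> \<tau>) *v f \<tau>"
  obtain D where D: "D \<subseteq> T" "countable (T - D)" "\<forall>t\<in>T - D. \<sigma> t = t" "\<forall>t\<in>D. has_delta_derivative T H (?h t) t"
    and H_cont: "continuous_on T H" using H unfolding delta_pre_antiderivative_def by blast
  \<comment> \<open>Its complement in \<open>T\<close> consists of the points whose shift is
    exceptional; the shift maps them injectively into \<open>T - D\<close>, so they are countably
    many and right-dense.\<close>
  let ?D = "{t \<in> T. t + p \<in> D}"
  have "T - ?D \<subseteq> (\<lambda>t. t - p) ` (T - D)"
  proof
    fix s assume "s \<in> T - ?D"
    then have "s + p \<in> T - D" using shift_in by auto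
    then show "s \<in> (\<lambda>t. t - p) ` (T - D)" by (intro image_eqI[of _ _ "s + p"]) auto
  qed
  then have "countable (T - ?D)" using D(2) by (meson countable_image countable_subset)
  moreover have "\<sigma> s = s" if "s \<in> T - ?D" for s
    using D(3) that shift_in[of s] shift_jump[of s] by auto
  moreover have "has_delta_derivative T (\<lambda>t. H (t + p)) (?h (s + p)) s" if "s \<in> ?D" for s
    using D(4) that by (intro has_delta_derivative_shift) auto
  moreover have "continuous_on T (\<lambda>t. H (t + p))"
    by (rule continuous_on_compose2[OF H_cont]) (auto intro: continuous_on_add shift_in)
  ultimately have "delta_pre_antiderivative T (\<lambda>s. ?h (s + p)) (\<lambda>t. H (t + p))"
    unfolding delta_pre_antiderivative_def by (intro conjI exI[of _ ?D]) auto
  then have "delta_pre_antiderivative T ?h (\<lambda>t. \<Phi> (t0 + p) t0 *v H (t + p))"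
  proof (rule delta_pre_antiderivative_linear[OF matrix_vector_mult.bounded_linear_right])
    fix s assume s: "s \<in> T"
    have "\<Phi> (t0 + p) t0 *v ?h (s + p) = (\<Phi> (t0 + p) t0 ** \<Phi> t0 (\<sigma> s + p)) *v f s"
      using f s by (simp add: periodic_on_def shift_jump matrix_vector_mul_assoc)
    also have "\<Phi> (t0 + p) t0 ** \<Phi> t0 (\<sigma> s + p) = \<Phi> (t0 + p) (\<sigma> s + p)"
      using s t0 by (intro transition_matrix_mult shift_in forward_jump_in)
    also have "\<dots> = \<Phi> t0 (\<sigma> s)" using s t0 by (intro transition_matrix_shift forward_jump_in)
    finally show "?h s = \<Phi> (t0 + p) t0 *v ?h (s + p)" by simp
  qed
  from delta_pre_antiderivative_diff_unique[OF this H t0 t] show ?thesis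
    by (simp add: matrix_vector_mult.diff_right)
qed

text \<open>Periodicity at \<open>t0\<close> alone is the stated condition. For other
  \<open>t\<close>, the increment of \<open>H\<close> from \<open>t0\<close> to \<open>t + p\<close>
  is split at \<open>t0 + p\<close>: the monodromy matrix sends the first part together with
  \<open>x0\<close> to \<open>x0\<close>, and the second part to the increment of \<open>H\<close>
  from \<open>t0\<close> to \<open>t\<close>.\<close>

lemma nonhomogeneous_periodic_iff:
  assumes t0: "t0 \<in> T" and f: "periodic_on T p f"
    and H: "delta_pre_antiderivative T (\<lambda>\<tau>. \<Phi> t0 (\<sigma> \<tau>) *v f \<tau>) H"
  shows "periodic_on T p (nonhomogeneous_solution T A f t0 x0) \<longleftrightarrow>
    \<Phi> (t0 + p) t0 *v (x0 + (H (t0 + p) - H t0)) = x0"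
    (is "?P \<longleftrightarrow> ?B *v (x0 + ?J) = x0")
proof
  let ?x = "nonhomogeneous_solution T A f t0 x0"
  note eq = nonhomogeneous_solution_eq[OF t0 _ H]
  show "?B *v (x0 + ?J) = x0" if ?P
  proof -
    have "?x (t0 + p) = ?x t0" using that t0 by (simp add: periodic_on_def)
    then show ?thesis unfolding eq[OF t0] eq[OF shift_in[OF t0]] by (simp add: transition_matrix_self t0)
  qed
  assume B: "?B *v (x0 + ?J) = x0"
  show ?P
    unfolding periodic_on_def
  proof
    fix t assume t: "t \<in> T"
    have "?x (t + p) = \<Phi> t t0 *v (?B *v (x0 + (H (t + p) - H t0)))"
      unfolding eq[OF shift_in[OF t]] transition_matrix_shift_left[OF t0 t] by (simp add: matrix_vector_mul_assoc)
    also have "x0 + (H (t + p) - H t0) = (x0 + ?J) + (H (t + p) - H (t0 + p))" by simp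
    also have "?B *v \<dots> = x0 + (H t - H t0)"
      by (subst matrix_vector_mult.add_right) (simp only: B antiderivative_shift[OF t0 t f H])
    finally show "?x (t + p) = ?x t" using eq[OF t] by simp
  qed
qed

lemma homogeneous_periodic_iff:
  assumes t0: "t0 \<in> T"
  shows "(\<exists>z. homogeneous_solution T A t0 z0 z \<and> periodic_on T p z) \<longleftrightarrow> \<Phi> (t0 + p) t0 *v z0 = z0"
proof
  have sol: "has_delta_derivative T (\<lambda>t. \<Phi> t t0 *v z0) (A t *v (\<Phi> t t0 *v z0)) t" if "t \<in> T" for t
    by (rule matrix_solution_vector[OF transition_matrix_derivative[OF t0 that]])
  assume "\<exists>z. homogeneous_solution T A t0 z0 z \<and> periodic_on T p z"
  then obtain z where z: "\<And>t. t \<in> T \<Longrightarrow> has_delta_derivative T z (A t *v z t) t" "z t0 = z0" "periodic_on T p z"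
    unfolding homogeneous_solution_def by blast
  have "z (t0 + p) = \<Phi> (t0 + p) t0 *v z0"
    by (rule vector_solution_unique[where x = z and y = "\<lambda>t. \<Phi> t t0 *v z0" and a = t0])
      (use z(1,2) sol t0 shift_in transition_matrix_self in auto)
  then show "\<Phi> (t0 + p) t0 *v z0 = z0" using z t0 by (simp add: periodic_on_def)
next
  have sol: "has_delta_derivative T (\<lambda>t. \<Phi> t t0 *v z0) (A t *v (\<Phi> t t0 *v z0)) t" if "t \<in> T" for t
    by (rule matrix_solution_vector[OF transition_matrix_derivative[OF t0 that]])
  assume B: "\<Phi> (t0 + p) t0 *v z0 = z0"
  have "\<Phi> (t + p) t0 *v z0 = \<Phi> t t0 *v z0" if "t \<in> T" for t
    unfolding transition_matrix_shift_left[OF t0 that] matrix_vector_mul_assoc[symmetric] B ..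
  then show "\<exists>z. homogeneous_solution T A t0 z0 z \<and> periodic_on T p z"
    using sol t0 by (intro exI[of _ "\<lambda>t. \<Phi> t t0 *v z0"])
      (auto simp: homogeneous_solution_def periodic_on_def transition_matrix_self)
qed

text \<open>The factor \<open>v (k \<tau>)\<close> compensates the monodromy matrix, so that \<open>f\<close> is periodic while
  the integrand of the variation of constants formula is the constant \<open>w / p\<close> on \<open>[t0, t0 + p)\<close>.\<close>

lemma periodic_forcing_exists:
  assumes t0: "t0 \<in> T"
  obtains f H where "f \<in> C_prd T" "periodic_on T p f"
    "delta_pre_antiderivative T (\<lambda>\<tau>. \<Phi> t0 (\<sigma> \<tau>) *v f \<tau>) H" "H (t0 + p) - H t0 = w"
proof -
  let ?B = "\<Phi> (t0 + p) t0" and ?C = "\<Phi> t0 (t0 + p)"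
  define u where "u = (1 / p) *\<^sub>R w"
  \<comment> \<open>As \<open>?C\<close> is the inverse of \<open>?B\<close>, this is
    \<open>?B\<close> to the power \<open>- k\<close> applied to \<open>u\<close>, written with
    natural exponents.\<close>
  define v where "v k = (if k \<ge> 0 then (((*v) ?C) ^^ nat k) u else (((*v) ?B) ^^ nat (- k)) u)" for k :: int
  define k where "k \<tau> = \<lfloor>(\<tau> - t0) / p\<rfloor>" for \<tau>
  \<comment> \<open>The point \<open>\<sigma> \<tau>\<close> may already lie in a later period, but
    the index is that of \<open>\<tau>\<close>; this keeps the integrand constant on all of
    \<open>[t0, t0 + p)\<close>.\<close>
  define f where "f \<tau> = \<Phi> (\<sigma> \<tau>) t0 *v v (k \<tau>)" for \<tau>
  have BC: "?B *v (?C *v x) = x" for x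
    using transition_matrix_inverse[of t0 "t0 + p"] t0 shift_in by (simp add: matrix_vector_mul_assoc)
  have v_Suc: "?B *v v (j + 1) = v j" for j
  proof (cases "j \<ge> 0")
    case True
    then have "nat (j + 1) = Suc (nat j)" by simp
    then show ?thesis using True BC by (simp add: v_def)
  next
    case False
    then have "nat (- j) = Suc (nat (- (j + 1)))" by simp
    then have "v j = ?B *v (((*v) ?B) ^^ nat (- (j + 1))) u" using False by (simp add: v_def)
    also have "(((*v) ?B) ^^ nat (- (j + 1))) u = v (j + 1)" using False by (cases "j = -1") (auto simp: v_def)
    finally show ?thesis by simp
  qed
  have f_per: "periodic_on T p f"
    unfolding periodic_on_def
  proof
    fix t assume t: "t \<in> T"
    have "(t + p - t0) / p = (t - t0) / p + 1" using p_pos by (simp add: field_simps)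
    then have "k (t + p) = k t + 1" by (simp add: k_def)
    then have "f (t + p) = \<Phi> (\<sigma> t) t0 *v (?B *v v (k t + 1))"
      using t transition_matrix_shift_left[OF t0 forward_jump_in[OF t]]
      by (simp add: f_def shift_jump matrix_vector_mul_assoc)
    then show "f (t + p) = f t" unfolding v_Suc f_def .
  qed
  have k_iff: "k \<tau> = j \<longleftrightarrow> t0 + of_int j * p \<le> \<tau> \<and> \<tau> < t0 + (of_int j + 1) * p" for \<tau> j
    unfolding k_def floor_eq_iff using p_pos by (auto simp: field_simps)
  have k_mono: "k x \<le> k y" if "x \<le> y" for x y
    unfolding k_def using that p_pos by (intro floor_mono divide_right_mono) auto
  have f_C: "f \<in> C_prd T"
    unfolding C_prd_def
  proof (intro CollectI allI)
    fix a b
    \<comment> \<open>The ends of the part of the j-th period inside \<open>[a, b)\<close>; the part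
      is empty when they come in the wrong order.\<close>
    let ?c = "\<lambda>j::int. max a (t0 + of_int j * p)" and ?d = "\<lambda>j::int. min b (t0 + (of_int j + 1) * p)"
    have piece: "t \<in> {?c j..<?d j} \<longleftrightarrow> t \<in> {a..<b} \<and> k t = j" for t j
      unfolding k_iff atLeastLessThan_iff max.bounded_iff min_less_iff_conj by blast
    let ?S = "(\<lambda>j. (?c j, ?d j)) ` {k a..k b}"
    have "(\<Union>(c, d)\<in>?S. {c..<d} \<inter> T) = (\<Union>j\<in>{k a..k b}. {t \<in> T. t \<in> {a..<b} \<and> k t = j})"
      using piece by blast
    also have "\<dots> = {a..<b} \<inter> T" by (auto simp: k_mono)
    finally have "{a..<b} \<inter> T = (\<Union>(c, d)\<in>?S. {c..<d} \<inter> T)" ..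
    moreover have "\<forall>(c, d)\<in>?S. \<exists>g. rd_continuous T g \<and> (\<forall>t\<in>{c..<d} \<inter> T. f t = g t)"
    proof clarify
      fix j
      have "continuous_on T (\<lambda>t. \<Phi> t t0 *v v j)"
        by (rule matrix_vector_mult.continuous_on[OF transition_matrix_continuous[OF t0] continuous_on_const])
      then have "rd_continuous T (\<lambda>t. \<Phi> (\<sigma> t) t0 *v v j)" by (rule rd_continuous_forward_jump)
      then show "\<exists>g. rd_continuous T g \<and> (\<forall>t\<in>{?c j..<?d j} \<inter> T. f t = g t)"
        using piece by (intro exI[of _ "\<lambda>t. \<Phi> (\<sigma> t) t0 *v v j"]) (simp add: f_def)
    qed
    ultimately show "\<exists>S. finite S \<and> {a..<b} \<inter> T = (\<Union>(c, d)\<in>S. {c..<d} \<inter> T) \<and>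
       (\<forall>(c, d)\<in>S. \<exists>g. rd_continuous T g \<and> (\<forall>t\<in>{c..<d} \<inter> T. f t = g t))"
      by (intro exI[of _ ?S]) auto
  qed
  obtain H where H: "delta_pre_antiderivative T (\<lambda>\<tau>. \<Phi> t0 (\<sigma> \<tau>) *v f \<tau>) H"
    using variation_antiderivative_exists[OF t0 f_C] by blast
  have h: "\<Phi> t0 (\<sigma> \<tau>) *v f \<tau> = u" if "\<tau> \<in> T" "t0 \<le> \<tau>" "\<tau> < t0 + p" for \<tau>
  proof -
    have "k \<tau> = 0" using k_iff[of \<tau> 0] that by simp
    then have "f \<tau> = \<Phi> (\<sigma> \<tau>) t0 *v u" by (simp add: f_def v_def)
    then show ?thesis
      using transition_matrix_inverse[of "\<sigma> \<tau>" t0] that(1) t0 forward_jump_in by (simp add: matrix_vector_mul_assoc)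
  qed
  obtain D where D: "D \<subseteq> T" "countable (T - D)" "\<forall>t\<in>T - D. \<sigma> t = t"
    "\<forall>t\<in>D. has_delta_derivative T H (\<Phi> t0 (\<sigma> t) *v f t) t"
    and H_cont: "continuous_on T H" using H unfolding delta_pre_antiderivative_def by blast
  have lin: "has_delta_derivative T (\<lambda>s. s *\<^sub>R u) u t" for t
    by (auto simp: has_delta_derivative_def simp flip: scaleR_diff_left intro!: exI[of _ 1])
  \<comment> \<open>Subtracting the antiderivative \<open>s *\<^sub>R u\<close> of the constant
    integrand leaves derivative 0 off a countable set over one period, so the mean value inequality
    evaluates the integral.\<close>
  have "norm (H (t0 + p) - (t0 + p) *\<^sub>R u - (H t0 - t0 *\<^sub>R u)) \<le> 0 * (t0 + p - t0)"
  proof (rule delta_mean_value[where F = "\<lambda>s. H s - s *\<^sub>R u" and N = "T - D"])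
    show "continuous_on T (\<lambda>s. H s - s *\<^sub>R u)" by (intro continuous_intros H_cont)
    show "\<exists>D'. has_delta_derivative T (\<lambda>s. H s - s *\<^sub>R u) D' t \<and> norm D' \<le> 0"
      if "t \<in> T" "t0 \<le> t" "t < t0 + p" "t \<notin> T - D" for t
    proof -
      have "has_delta_derivative T (\<lambda>s. H s - s *\<^sub>R u) (\<Phi> t0 (\<sigma> t) *v f t - u) t"
        by (rule has_delta_derivative_diff[OF _ lin]) (use D(4) that in blast)
      then show ?thesis using h[OF that(1-3)] by (intro exI[of _ 0]) simp
    qed
  qed (use D t0 shift_in p_pos in auto)
  then have "H (t0 + p) - H t0 = p *\<^sub>R u" by (simp add: algebra_simps)
  also have "\<dots> = w" using p_pos by (simp add: u_def)
  finally show thesis using that f_C f_per H by blast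
qed

lemma periodic_solutions_iff:
  "(\<forall>t0\<in>T. \<forall>f\<in>C_prd T. periodic_on T p f \<longrightarrow>
      (\<exists>x0. periodic_on T p (nonhomogeneous_solution T A f t0 x0)))
   \<longleftrightarrow> \<not> (\<exists>z0 t0. z0 \<noteq> 0 \<and> t0 \<in> T \<and> (\<exists>z. homogeneous_solution T A t0 z0 z \<and> periodic_on T p z))"
    (is "?a \<longleftrightarrow> \<not> ?b")
proof
  show "\<not> ?b" if ?a
  proof
    assume ?b
    then obtain z0 t0 where z0: "z0 \<noteq> 0" and t0: "t0 \<in> T" and Bz: "\<Phi> (t0 + p) t0 *v z0 = z0"
      using homogeneous_periodic_iff by blast
    let ?B = "\<Phi> (t0 + p) t0"
    have "\<not> surj ((*v) (mat 1 - ?B))"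
    proof
      assume "surj ((*v) (mat 1 - ?B))"
      then have "invertible (mat 1 - ?B)"
        using matrix_right_invertible_surjective invertible_right_inverse by blast
      moreover have "(mat 1 - ?B) *v z0 = 0" using Bz by (simp add: matrix_vector_mult.diff_left)
      ultimately show False using invertible_zero_imp(1) z0 by blast
    qed
    then obtain y where y: "\<forall>x. y \<noteq> (mat 1 - ?B) *v x" unfolding surj_def by blast
    \<comment> \<open>The integral is prescribed as \<open>\<Phi> t0 (t0 + p) *v y\<close> because
      the periodicity criterion applies \<open>?B\<close> to it, which returns \<open>y\<close>. A
      periodic solution would then put \<open>y\<close> in the range of
      \<open>mat 1 - ?B\<close>.\<close>
    obtain f H where f: "f \<in> C_prd T" "periodic_on T p f" "delta_pre_antiderivative T (\<lambda>\<tau>. \<Phi> t0 (\<sigma> \<tau>) *v f \<tau>) H"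
      and H: "H (t0 + p) - H t0 = \<Phi> t0 (t0 + p) *v y"
      using periodic_forcing_exists[OF t0, of "\<Phi> t0 (t0 + p) *v y"] by blast
    obtain x0 where "periodic_on T p (nonhomogeneous_solution T A f t0 x0)" using \<open>?a\<close> t0 f by blast
    then have "?B *v (x0 + \<Phi> t0 (t0 + p) *v y) = x0"
      using nonhomogeneous_periodic_iff[OF t0 f(2,3)] H by simp
    moreover have "?B *v (\<Phi> t0 (t0 + p) *v y) = y"
      using transition_matrix_inverse[of t0 "t0 + p"] t0 shift_in by (simp add: matrix_vector_mul_assoc)
    ultimately have "(mat 1 - ?B) *v x0 = y"
      by (simp add: matrix_vector_mult.diff_left matrix_vector_mult.add_right algebra_simps)
    then show False using y by metis
  qed
  show ?a if "\<not> ?b"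
  proof (intro ballI impI)
    fix t0 and f :: "real \<Rightarrow> real^'n" assume t0: "t0 \<in> T" and f: "f \<in> C_prd T" "periodic_on T p f"
    let ?B = "\<Phi> (t0 + p) t0"
    have "x = 0" if "(mat 1 - ?B) *v x = 0" for x
    proof -
      have "?B *v x = x" using that by (simp add: matrix_vector_mult.diff_left)
      then have "\<exists>z. homogeneous_solution T A t0 x z \<and> periodic_on T p z"
        by (rule homogeneous_periodic_iff[OF t0, THEN iffD2])
      then show ?thesis using \<open>\<not> ?b\<close> t0 by metis
    qed
    then have "invertible (mat 1 - ?B)"
      unfolding invertible_left_inverse matrix_left_invertible_ker by blast
    then have "surj ((*v) (mat 1 - ?B))"
      unfolding invertible_right_inverse matrix_right_invertible_surjective .
    obtain H where H: "delta_pre_antiderivative T (\<lambda>\<tau>. \<Phi> t0 (\<sigma> \<tau>) *v f \<tau>) H"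
      using variation_antiderivative_exists[OF t0 f(1)] by blast
    obtain x0 where "?B *v (H (t0 + p) - H t0) = (mat 1 - ?B) *v x0"
      using \<open>surj ((*v) (mat 1 - ?B))\<close> unfolding surj_def by blast
    then have "?B *v (x0 + (H (t0 + p) - H t0)) = x0"
      by (simp add: matrix_vector_mult.diff_left matrix_vector_mult.add_right algebra_simps)
    then show "\<exists>x0. periodic_on T p (nonhomogeneous_solution T A f t0 x0)"
      using nonhomogeneous_periodic_iff[OF t0 f(2) H] by blast
  qed
qed

end

theorem theorem3p13:
  fixes p :: real and T :: "real set" and A :: "real \<Rightarrow> real^'n^'n"
  assumes "p > 0"
    and "periodic_time_scale T p"
    and "periodic_on T p A"
    and "uniformly_regressive T A"
  shows "(\<forall>t0\<in>T. \<forall>f\<in>C_prd T. periodic_on T p f \<longrightarrow>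
            (\<exists>x0. periodic_on T p (nonhomogeneous_solution T A f t0 x0)))
     \<longleftrightarrow> \<not> (\<exists>z0 t0. z0 \<noteq> 0 \<and> t0 \<in> T \<and>
            (\<exists>z. homogeneous_solution T A t0 z0 z \<and> periodic_on T p z))"
proof -
  have shift: "t + p \<in> T" "graininess T t = graininess T (t + p)" if "t \<in> T" for t
    using assms(2) that unfolding periodic_time_scale_def by auto
  have "closed T" "T \<noteq> {}" using assms(2) by (auto simp: periodic_time_scale_def time_scale_def)
  then obtain t where t: "t \<in> T" by blast
  \<comment> \<open>The multiples of \<open>p\<close> added to one point of \<open>T\<close> show
    that \<open>T\<close> is unbounded above.\<close>
  have iter: "t + real n * p \<in> T" for n
  proof (induction n)
    case (Suc n)
    then show ?case using shift(1)[of "t + real n * p"] by (simp add: algebra_simps)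
  qed (simp add: t)
  have "\<exists>s\<in>T. x < s" for x
  proof -
    obtain n where "x - t < real n * p" using reals_Archimedean3[OF \<open>p > 0\<close>] by blast
    then show ?thesis using iter[of n] by (intro bexI[of _ "t + real n * p"]) auto
  qed
  \<comment> \<open>Equal graininess at \<open>t\<close> and \<open>t + p\<close> says that the
    forward jump commutes with the shift.\<close>
  then interpret periodic_regressive_system T A p
    using \<open>closed T\<close> assms(1,3,4) shift
    by unfold_locales (auto simp: uniformly_regressive_def periodic_on_def graininess_def)
  show ?thesis by (rule periodic_solutions_iff)
qed

end
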